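(* Let $S$ be a Polish space, $\mu\in P(S)$ and $\delta>0$. Suppose that $c:S\times S\to\mathbb{R}_+$ is a nonnegative lower semicontinuous function satisfying $c(x,y)=0$ if and only if $x=y$, and that $f:S\to\mathbb{R}$ is upper semicontinuous with $f\in L^1(d\mu)$. With $\Phi_{\mu,\delta}$, $\Lambda_{c,f}$, $I(\pi)$, $J(\lambda,\phi)$, $I$, $J$ as defined in the context: (a) $I=J$, that is, $$\sup\{I(\pi):\pi\in\Phi_{\mu,\delta}\}=\inf\{J(\lambda,\phi):(\lambda,\phi)\in\Lambda_{c,f}\}.$$ (b) For any $\lambda\ge 0$ define $\phi_\lambda:S\to\mathbb{R}\cup\{\infty\}$ by $\phi_\lambda(x):=\sup_{y\in S}\{f(y)-\lambda c(x,y)\}$. There exists a dual optimizer of the form $(\lambda,\phi_\lambda)$ for some $\lambda\ge0$. In addition, any feasible $\pi^*\in\Phi_{\mu,\delta}$ and $(\lambda^*,\phi_{\lambda^*})\in\Lambda_{c,f}$ are primal and dual optimizers, satisfying $I(\pi^* )=J(\lambda^*,\phi_{\lambda^*})$, if and only if $$f(y)-\lambda^*c(x,y)=\sup_{z\in S}\{f(z)-\lambda^*c(x,z)\}\quad \text{for } \pi^*\text{-almost every }(x,y),$$ and $$\lambda^*\left(\int c(x,y)\,d\pi^*(x,y)-\delta\right)=0.$$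
   Context: $P(S)$ is the set of Borel probability measures on $S$; $\Pi(\mu,\nu)$ is the set of Borel probability measures on $S\times S$ with first marginal $\mu$ and second marginal $\nu$. $\mathcal{U}(S)$ is the universal $\sigma$-algebra of $S$ (the intersection over all $\mu\in P(S)$ of the $\mu$-completions of the Borel $\sigma$-algebra), and $\mathfrak{m}_{\mathcal U}(S;\overline{\mathbb R})$ is the set of measurable functions $(S,\mathcal U(S))\to(\overline{\mathbb R},\mathcal B(\overline{\mathbb R}))$, $\overline{\mathbb R}=\mathbb R\cup\{\pm\infty\}$. Integrals of universally measurable functions against $\mu$ are with respect to the extension of $\mu$ to its completion. Primal problem: $$\Phi_{\mu,\delta}:=\Big\{\pi\in\bigcup_{\nu\in P(S)}\Pi(\mu,\nu):\int c\,d\pi\le\delta\Big\},\qquad I(\pi):=\int f(y)\,d\pi(x,y),\qquad I:=\sup\{I(\pi):\pi\in\Phi_{\mu,\delta}\}.$$ By convention the supremum is interpreted as being taken only over those $\pi$ with $\int f^-(y)\,d\pi(x,y)<\infty$, where $f^-=\max(-f,0)$ (so that $I(\pi)$ is well-defined). Dual problem: $$\Lambda_{c,f}:=\{(\lambda,\phi):\lambda\ge0,\ \phi\in\mathfrak{m}_{\mathcal U}(S;\overline{\mathbb R}),\ \phi(x)+\lambda c(x,y)\ge f(y)\text{ for all }x,y\in S\},$$ $$J(\lambda,\phi):=\lambda\delta+\int\phi\,d\mu,\qquad J:=\inf\{J(\lambda,\phi):(\lambda,\phi)\in\Lambda_{c,f}\}.$$ (The integral $\int\phi\,d\mu\in(-\infty,\infty]$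 is well-defined since $\phi\ge f$.) A primal optimizer is a $\pi^*\in\Phi_{\mu,\delta}$ with $I(\pi^* )=I$; a dual optimizer is an element of $\Lambda_{c,f}$ attaining $J$.
   Formalization: The "only if" half of the optimality criterion in (b) is asserted only when the common value I = J is finite; it fails when I = J = ∞ (e.g. S = ℝ, c = |x−y|, f(y) = y², μ = δ₀, δ = 1). The "if" half, (a) and existence of a dual optimizer are unconditional. *)

theory Defs
  imports "HOL-Probability.Probability"
begin

definition lower_semicontinuous :: "('a::topological_space \<Rightarrow> real) \<Rightarrow> bool" where
  "lower_semicontinuous g \<longleftrightarrow> (\<forall>a. open {x. a < g x})"

definition upper_semicontinuous :: "('a::topological_space \<Rightarrow> real) \<Rightarrow> bool" where
  "upper_semicontinuous g \<longleftrightarrow> (\<forall>a. open {x. g x < a})"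

definition borel_prob_measures :: "'a::topological_space measure set" where
  "borel_prob_measures = {\<mu>. sets \<mu> = sets borel \<and> prob_space \<mu>}"

definition couplings ::
    "'a::topological_space measure \<Rightarrow> 'a measure \<Rightarrow> ('a \<times> 'a) measure set" where
  "couplings \<mu> \<nu> =
     {\<pi> \<in> borel_prob_measures. distr \<pi> borel fst = \<mu> \<and> distr \<pi> borel snd = \<nu>}"

definition universal_algebra :: "'a::topological_space measure" where
  "universal_algebra = sigma UNIV (\<Inter>\<mu>\<in>borel_prob_measures. sets (completion \<mu>))"

text \<open>
  The generating family above already is a \<open>\<sigma>\<close>-algebra, so passing to the generated
  \<open>\<sigma>\<close>-algebra adds no sets.
\<close>

lemma space_universal_algebra [simp]: "space universal_algebra = UNIV"
  by (simp add: universal_algebra_def)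

lemma sets_universal_algebra:
  "sets (universal_algebra :: 'a::topological_space measure) =
     (\<Inter>\<mu>\<in>borel_prob_measures. sets (completion (\<mu> :: 'a measure)))"
proof -
  have sp: "space \<mu> = UNIV" if "\<mu> \<in> borel_prob_measures" for \<mu> :: "'a measure"
    using that sets_eq_imp_space_eq[of \<mu> borel] by (simp add: borel_prob_measures_def)
  have "return borel undefined \<in> (borel_prob_measures :: 'a measure set)"
    by (auto simp: borel_prob_measures_def intro: prob_space_return)
  then have ne: "(borel_prob_measures :: 'a measure set) \<noteq> {}"
    by blast
  have sa: "sigma_algebra UNIV (sets (completion \<mu>))" if "\<mu> \<in> borel_prob_measures"
    for \<mu> :: "'a measure"
    using sets.sigma_algebra_axioms[of "completion \<mu>"] sp[OF that] by simp
  have "sigma_algebra UNIV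
      (\<Inter>\<mu>\<in>borel_prob_measures. sets (completion (\<mu> :: 'a measure)))"
    unfolding sigma_algebra_iff2
  proof (intro conjI ballI allI impI)
    fix A :: "nat \<Rightarrow> 'a set"
    assume "range A \<subseteq> (\<Inter>\<mu>\<in>borel_prob_measures. sets (completion \<mu>))"
    then show "(\<Union>i. A i) \<in> (\<Inter>\<mu>\<in>borel_prob_measures. sets (completion \<mu>))"
      by (auto intro!: sets.countable_UN)
  qed (use sa ne in \<open>auto simp: sigma_algebra_iff2\<close>)
  then show ?thesis
    by (simp add: universal_algebra_def sigma_algebra.sigma_sets_eq
        sigma_algebra.sets_measure_of_eq)
qed

text \<open>
  The integral of the positive part minus the integral of the negative part (\<^const>\<open>e2ennreal\<close>
  maps negative values to \<open>0\<close>).  It is meaningful only if one of the two is finite: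
  \<open>\<infinity> - \<infinity> = \<infinity>\<close> in \<^typ>\<open>ereal\<close>.
\<close>

definition ext_integral :: "'a measure \<Rightarrow> ('a \<Rightarrow> ereal) \<Rightarrow> ereal" where
  "ext_integral M g =
     enn2ereal (\<integral>\<^sup>+ x. e2ennreal (g x) \<partial>M) - enn2ereal (\<integral>\<^sup>+ x. e2ennreal (- g x) \<partial>M)"

definition transport_cost ::
    "('a::topological_space \<Rightarrow> 'a \<Rightarrow> real) \<Rightarrow> ('a \<times> 'a) measure \<Rightarrow> ereal" where
  "transport_cost c \<pi> = ext_integral \<pi> (\<lambda>(x, y). ereal (c x y))"

definition primal_feasible ::
    "('a::topological_space \<Rightarrow> 'a \<Rightarrow> real) \<Rightarrow> 'a measure \<Rightarrow> real \<Rightarrow> ('a \<times> 'a) measure set" where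
  "primal_feasible c \<mu> \<delta> =
     {\<pi> \<in> (\<Union>\<nu>\<in>borel_prob_measures. couplings \<mu> \<nu>). transport_cost c \<pi> \<le> ereal \<delta>}"

definition primal_objective ::
    "('a::topological_space \<Rightarrow> real) \<Rightarrow> ('a \<times> 'a) measure \<Rightarrow> ereal" where
  "primal_objective f \<pi> = ext_integral \<pi> (\<lambda>(x, y). ereal (f y))"

definition neg_part_integrable ::
    "('a::topological_space \<Rightarrow> real) \<Rightarrow> ('a \<times> 'a) measure \<Rightarrow> bool" where
  "neg_part_integrable f \<pi> \<longleftrightarrow> (\<integral>\<^sup>+ (x, y). ennreal (max (- f y) 0) \<partial>\<pi>) < \<infinity>"

definition primal_value ::
    "('a::topological_space \<Rightarrow> 'a \<Rightarrow> real) \<Rightarrow> ('a \<Rightarrow> real) \<Rightarrow> 'a measure \<Rightarrow> real \<Rightarrow> ereal" where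
  "primal_value c f \<mu> \<delta> =
     (SUP \<pi>\<in>{\<pi> \<in> primal_feasible c \<mu> \<delta>. neg_part_integrable f \<pi>}. primal_objective f \<pi>)"

definition primal_optimizer ::
    "('a::topological_space \<Rightarrow> 'a \<Rightarrow> real) \<Rightarrow> ('a \<Rightarrow> real) \<Rightarrow> 'a measure \<Rightarrow> real \<Rightarrow>
      ('a \<times> 'a) measure \<Rightarrow> bool" where
  "primal_optimizer c f \<mu> \<delta> \<pi> \<longleftrightarrow>
     \<pi> \<in> primal_feasible c \<mu> \<delta> \<and> neg_part_integrable f \<pi> \<and>
     primal_objective f \<pi> = primal_value c f \<mu> \<delta>"

definition dual_feasible ::
    "('a::topological_space \<Rightarrow> 'a \<Rightarrow> real) \<Rightarrow> ('a \<Rightarrow> real) \<Rightarrow> (real \<times> ('a \<Rightarrow> ereal)) set" where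
  "dual_feasible c f =
     {(l, \<phi>). 0 \<le> l \<and> \<phi> \<in> borel_measurable universal_algebra \<and>
        (\<forall>x y. ereal (f y) \<le> \<phi> x + ereal (l * c x y))}"

definition dual_objective ::
    "'a::topological_space measure \<Rightarrow> real \<Rightarrow> real \<times> ('a \<Rightarrow> ereal) \<Rightarrow> ereal" where
  "dual_objective \<mu> \<delta> = (\<lambda>(l, \<phi>). ereal (l * \<delta>) + ext_integral (completion \<mu>) \<phi>)"

definition dual_value ::
    "('a::topological_space \<Rightarrow> 'a \<Rightarrow> real) \<Rightarrow> ('a \<Rightarrow> real) \<Rightarrow> 'a measure \<Rightarrow> real \<Rightarrow> ereal" where
  "dual_value c f \<mu> \<delta> = (INF p\<in>dual_feasible c f. dual_objective \<mu> \<delta> p)"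

definition dual_optimizer ::
    "('a::topological_space \<Rightarrow> 'a \<Rightarrow> real) \<Rightarrow> ('a \<Rightarrow> real) \<Rightarrow> 'a measure \<Rightarrow> real \<Rightarrow>
      real \<times> ('a \<Rightarrow> ereal) \<Rightarrow> bool" where
  "dual_optimizer c f \<mu> \<delta> p \<longleftrightarrow>
     p \<in> dual_feasible c f \<and> dual_objective \<mu> \<delta> p = dual_value c f \<mu> \<delta>"

definition phi ::
    "('a::topological_space \<Rightarrow> 'a \<Rightarrow> real) \<Rightarrow> ('a \<Rightarrow> real) \<Rightarrow> real \<Rightarrow> 'a \<Rightarrow> ereal" where
  "phi c f l x = (SUP y. ereal (f y - l * c x y))"

text \<open>
  In the complementary slackness conditions the transport cost of a feasible \<open>\<pi>\<close> is a real number,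
  so the second condition is an ordinary equation between reals.
\<close>

definition complementary_slackness ::
    "('a::topological_space \<Rightarrow> 'a \<Rightarrow> real) \<Rightarrow> ('a \<Rightarrow> real) \<Rightarrow> real \<Rightarrow>
      ('a \<times> 'a) measure \<Rightarrow> real \<Rightarrow> bool" where
  "complementary_slackness c f \<delta> \<pi> l \<longleftrightarrow>
     (AE (x, y) in \<pi>. ereal (f y - l * c x y) = (SUP z. ereal (f z - l * c x z))) \<and>
     ereal l * (transport_cost c \<pi> - ereal \<delta>) = 0"

text \<open>
  When the common optimal value is \<open>\<infinity>\<close>, optimality does not imply complementary slackness: on the
  reals take \<open>c x y = \<bar>x - y\<bar>\<close>, \<open>f y = y\<^sup>2\<close>, \<open>\<mu>\<close> the point mass at \<open>0\<close>, \<open>\<delta> = 1\<close>, \<open>l = 1\<close>, and a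
  coupling whose second marginal has first absolute moment \<open>1/2\<close> and infinite second moment.
  Slackness nevertheless always implies optimality.
\<close>

end

theory Submission
  imports Defs
begin

text \<open>
  The multiplier \<open>l\<close> is a price per unit of transport cost.  At a fixed price the problem splits over
  the starting points: a plan can send each \<open>x\<close> to a near maximizer of \<open>f y - l * c x y\<close>, so the
  supremum of \<open>\<integral>(f y - l * c x y) d\<pi>\<close> over all plans of finite cost is
  \<open>\<integral>phi c f l d\<mu>\<close>.  What remains is to find a
  price at which nothing is lost by relaxing the budget constraint.  Plans can be mixed, so the
  attainable pairs of cost and value form a convex set (\<open>convex_attainable\<close>) and the optimal
  value is a concave function of the budget.  Since \<open>\<delta> > 0\<close> is interior to its domain, a finite
  optimal value has a supergradient at \<open>\<delta>\<close> (\<open>supergradient_at_interior_point\<close>), and this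
  supergradient is the dual optimizer.  If the primal value is infinite, every price \<open>l \<ge> 0\<close> is
  optimal.

  The work is in choosing the near maximizers measurably.  The gain \<open>f y - l * c x y\<close> is only upper
  semicontinuous, so its supremum over \<open>y\<close> may not be seen on a countable dense set, and \<open>phi\<close> need
  not be Borel.  But the superlevel sets of the gain are closed in the product, and the projection
  of a closed set from a product with a Polish space is measurable for every completed measure
  (\<open>closed_projection_sets_completion\<close>).  A nested sequence of ever smaller balls, each the first one
  that still meets the fibre, turns this into a selection (\<open>closed_measurable_selection\<close>).  Countably
  many selections, one for each rational level, recover the supremum pointwise, which gives both the
  universal measurability of \<open>phi\<close> and, through the graphs of the selections, almost optimal plans.

  Weak duality and the complementary slackness conditions come from one identity
  (\<open>duality_gap\<close>): for a feasible pair, the dual objective exceeds the primal one by the integral of the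
  pointwise slack in the dual constraint plus \<open>l\<close> times the unused budget.  Both terms are nonnegative,
  and the slackness conditions say that both vanish.
\<close>

section \<open>Projections of closed sets\<close>

text \<open>
  For every radius, all but finitely many terms lie in finitely many balls, so the range of the
  sequence is totally bounded and its closure is compact.
\<close>

lemma convergent_subsequence_if_eventually_covered:
  fixes y :: "nat \<Rightarrow> 'b::complete_space"
  assumes cov: "\<And>e. e > 0 \<Longrightarrow> \<exists>k. finite k \<and> (\<forall>\<^sub>F n in sequentially. y n \<in> (\<Union>d\<in>k. ball d e))"
  shows "\<exists>l r. strict_mono (r :: nat \<Rightarrow> nat) \<and> (y \<circ> r) \<longlonglongrightarrow> l"
proof -
  let ?S = "closure (range y)"
  have "\<exists>k. finite k \<and> ?S \<subseteq> (\<Union>d\<in>k. ball d e)" if e: "e > 0" for e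
  proof -
    obtain k N where k: "finite k" "\<And>n. n \<ge> N \<Longrightarrow> y n \<in> (\<Union>d\<in>k. ball d (e/2))"
      using cov[of "e/2"] e by (auto simp: eventually_sequentially)
    (* closed balls of half the radius survive passing to the closure *)
    let ?k = "k \<union> y ` {..<N}"
    have "y n \<in> (\<Union>d\<in>?k. cball d (e/2))" for n
    proof (cases "n < N")
      case True
      then have "y n \<in> ?k" "y n \<in> cball (y n) (e/2)" using e by auto
      then show ?thesis by blast
    next
      case False then show ?thesis using k(2)[of n] by (force simp: less_imp_le)
    qed
    then have "?S \<subseteq> (\<Union>d\<in>?k. cball d (e/2))"
      using k(1) by (intro closure_minimal closed_UN image_subsetI) blast+
    also have "\<dots> \<subseteq> (\<Union>d\<in>?k. ball d e)" using e by fastforce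
    finally show ?thesis
      using k(1) by (intro exI[of _ ?k]) auto
  qed
  then have "compact ?S" by (simp add: compact_eq_totally_bounded complete_eq_closed)
  then have "seq_compact ?S" by (rule compact_imp_seq_compact)
  moreover have "\<forall>n. y n \<in> ?S" using closure_subset[of "range y"] by blast
  ultimately show ?thesis unfolding seq_compact_def by blast
qed

lemma dense_sequence:
  "\<exists>d :: nat \<Rightarrow> 'b::{metric_space, second_countable_topology}. \<forall>y. \<forall>e>0. \<exists>n. dist (d n) y < e"
proof -
  obtain D :: "'b set" where D: "countable D" "\<And>X. open X \<Longrightarrow> X \<noteq> {} \<Longrightarrow> \<exists>d\<in>D. d \<in> X"
    by (rule countable_dense_setE) blast
  have ne: "D \<noteq> {}" using D(2)[of UNIV] by auto
  have "\<exists>n. dist (from_nat_into D n) y < e" if "e > 0" for y e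
  proof -
    have "ball y e \<noteq> {}" using that by auto
    then obtain x where x: "x \<in> D" "x \<in> ball y e" using D(2)[of "ball y e"] by auto
    then obtain n where "from_nat_into D n = x"
      using from_nat_into_surj[OF D(1)] by blast
    then show ?thesis using x by (auto simp: dist_commute)
  qed
  then show ?thesis by blast
qed

text \<open>
  This is the argument behind Choquet's capacitability theorem.  Outer measure is continuous along
  increasing unions, so \<open>F\<close> can be restricted, step by step, to points whose second coordinate lies
  in finitely many balls of radius \<open>(1/2)^n\<close>, while the outer measure of the projection stays above \<open>r\<close>.
  The restrictions make the second coordinates totally bounded, and so a point that is adherent to
  every restricted projection is the projection of a point of \<open>F\<close>.  The intersection of the closures
  of the restricted projections is therefore a Borel set inside the projection.
\<close>

lemma closed_projection_inner_approximation:
  fixes F :: "('a::metric_space \<times> 'b::polish_space) set"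
  assumes F: "closed F" and fin: "finite_measure \<nu>" and sets: "sets \<nu> = sets borel"
    and r: "r < outer_measure_of \<nu> (fst ` F)"
  shows "\<exists>B\<in>sets \<nu>. B \<subseteq> fst ` F \<and> r \<le> emeasure \<nu> B"
proof -
  interpret finite_measure \<nu> by fact
  have sp: "space \<nu> = UNIV" using sets_eq_imp_space_eq[OF sets] by simp
  obtain d :: "nat \<Rightarrow> 'b" where d: "\<And>y e. e > 0 \<Longrightarrow> \<exists>n. dist (d n) y < e"
    using dense_sequence[where 'b='b] by blast
  define E where "E m n = (\<Union>i\<le>m. cball (d i) ((1/2)^n))" for m n :: nat
  have step: "\<exists>m. r < outer_measure_of \<nu> (fst ` (G \<inter> UNIV \<times> E m n))"
    if "r < outer_measure_of \<nu> (fst ` G)" for G and n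
  proof -
    let ?A = "\<lambda>m. fst ` (G \<inter> UNIV \<times> E m n)"
    have "\<exists>m. y \<in> E m n" for y
    proof -
      obtain m where "dist (d m) y < (1/2)^n" using d[of "(1/2)^n" y] by auto
      then have "y \<in> E m n" unfolding E_def by (intro UN_I[of m]) auto
      then show ?thesis ..
    qed
    then have "G = (\<Union>m. G \<inter> UNIV \<times> E m n)" by auto
    then have "fst ` G = (\<Union>m. ?A m)" by (metis image_UN)
    moreover have "incseq ?A"
    proof (intro incseq_SucI image_mono)
      show "G \<inter> UNIV \<times> E m n \<subseteq> G \<inter> UNIV \<times> E (Suc m) n" for m
        unfolding E_def atMost_Suc by blast
    qed
    ultimately have "(SUP m. outer_measure_of \<nu> (?A m)) = outer_measure_of \<nu> (fst ` G)"
      using SUP_outer_measure_of_incseq[of ?A \<nu>] by (simp add: sp)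
    with that have "r < (SUP m. outer_measure_of \<nu> (?A m))" by (simp only:)
    then show ?thesis by (simp only: less_SUP_iff) blast
  qed
  have "\<exists>G. \<forall>n. (G n \<subseteq> F \<and> r < outer_measure_of \<nu> (fst ` G n))
      \<and> (\<exists>m. G (Suc n) = G n \<inter> UNIV \<times> E m n)"
  proof (rule dependent_nat_choice)
    show "\<exists>G\<subseteq>F. r < outer_measure_of \<nu> (fst ` G)" using r by blast
  next
    fix G n assume G: "G \<subseteq> F \<and> r < outer_measure_of \<nu> (fst ` G)"
    then obtain m where "r < outer_measure_of \<nu> (fst ` (G \<inter> UNIV \<times> E m n))"
      using step by blast
    with G show "\<exists>G'. (G' \<subseteq> F \<and> r < outer_measure_of \<nu> (fst ` G')) \<and> (\<exists>m. G' = G \<inter> UNIV \<times> E m n)"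
      by (intro exI[of _ "G \<inter> UNIV \<times> E m n"] conjI exI[of _ m] refl) auto
  qed
  then obtain G where GF: "\<And>n. G n \<subseteq> F" and Gr: "\<And>n. r < outer_measure_of \<nu> (fst ` G n)"
    and GE: "\<And>n. \<exists>m. G (Suc n) = G n \<inter> UNIV \<times> E m n"
    by blast
  have dec: "decseq G" using GE by (intro decseq_SucI) (metis inf_le1)
  (* closures, since the restricted projections themselves need not be measurable *)
  define B where "B = (\<Inter>n. closure (fst ` G n))"
  have dec': "decseq (\<lambda>n. closure (fst ` G n))"
    using dec by (auto simp: decseq_def intro!: closure_mono image_mono)
  have cls: "closure X \<in> sets \<nu>" for X by (simp add: sets)
  have "r \<le> emeasure \<nu> (closure (fst ` G n))" for n
    using Gr[of n] outer_measure_of_mono[OF closure_subset[of "fst ` G n"], of \<nu>] cls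
    by simp
  then have "r \<le> (INF n. emeasure \<nu> (closure (fst ` G n)))" by (intro INF_greatest)
  also have "\<dots> = emeasure \<nu> B"
    unfolding B_def using cls dec' by (intro INF_emeasure_decseq) auto
  finally have rB: "r \<le> emeasure \<nu> B" .
  have "x \<in> fst ` F" if x: "x \<in> B" for x
  proof -
    have "\<exists>p\<in>G n. dist (fst p) x < (1/2)^n" for n
    proof -
      have "x \<in> closure (fst ` G n)" "(0::real) < (1/2)^n" using x by (auto simp: B_def)
      then obtain z where "z \<in> fst ` G n" "dist z x < (1/2)^n"
        unfolding closure_approachable by blast
      then show ?thesis by blast
    qed
    then obtain p where p: "\<And>n. p n \<in> G n" "\<And>n. dist (fst (p n)) x < (1/2)^n"
      by metis
    have "(\<lambda>n. dist (fst (p n)) x) \<longlonglongrightarrow> 0"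
    proof (rule tendsto_sandwich)
      show "\<forall>\<^sub>F n in sequentially. 0 \<le> dist (fst (p n)) x" by simp
      show "\<forall>\<^sub>F n in sequentially. dist (fst (p n)) x \<le> (1/2)^n"
        using p(2) by (intro always_eventually allI less_imp_le)
      show "(\<lambda>n. (1/2)^n :: real) \<longlonglongrightarrow> 0" by (rule LIMSEQ_power_zero) simp
    qed simp
    then have px: "(\<lambda>n. fst (p n)) \<longlonglongrightarrow> x" by (rule tendsto_dist_iff[THEN iffD2])
    have "\<exists>l s. strict_mono (s :: nat \<Rightarrow> nat) \<and> ((\<lambda>n. snd (p n)) \<circ> s) \<longlonglongrightarrow> l"
    proof (rule convergent_subsequence_if_eventually_covered)
      fix e :: real assume "e > 0"
      then obtain n where n: "(1/2)^n < e" using real_arch_pow_inv[of e "1/2"] by auto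
      obtain m where m: "G (Suc n) = G n \<inter> UNIV \<times> E m n" using GE by blast
      have "snd (p j) \<in> (\<Union>x\<in>d ` {..m}. ball x e)" if "j \<ge> Suc n" for j
      proof -
        have "p j \<in> G (Suc n)" using p(1)[of j] dec that by (auto simp: decseq_def)
        then have "snd (p j) \<in> E m n" unfolding m by (simp add: mem_Times_iff)
        then obtain i where i: "i \<le> m" "dist (d i) (snd (p j)) \<le> (1/2)^n"
          unfolding E_def by auto
        with n have "snd (p j) \<in> ball (d i) e" by simp
        with i(1) show ?thesis by blast
      qed
      then show "\<exists>k. finite k \<and> (\<forall>\<^sub>F j in sequentially. snd (p j) \<in> (\<Union>x\<in>k. ball x e))"
        unfolding eventually_sequentially by (intro exI[of _ "d ` {..m}"] conjI exI[of _ "Suc n"] allI impI) simp_all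
    qed
    then obtain l s where s: "strict_mono (s :: nat \<Rightarrow> nat)" "((\<lambda>n. snd (p n)) \<circ> s) \<longlonglongrightarrow> l"
      by blast
    have "(\<lambda>n. (fst (p (s n)), snd (p (s n)))) \<longlonglongrightarrow> (x, l)"
      using s(2) LIMSEQ_subseq_LIMSEQ[OF px s(1)] by (intro tendsto_Pair) (simp_all only: o_def)
    then have lim: "(\<lambda>n. p (s n)) \<longlonglongrightarrow> (x, l)" by simp
    have "p (s n) \<in> F" for n using p(1) GF by blast
    then have "(x, l) \<in> F" by (rule closed_sequentially[OF F _ lim])
    then show ?thesis by (rule image_eqI[of _ _ "(x, l)", rotated]) simp
  qed
  moreover have "B \<in> sets \<nu>" unfolding B_def using cls by auto
  ultimately show ?thesis using rB by blast
qed

text \<open>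
  Some Borel superset has the outer measure of the projection as its measure, and a countable union
  of inner approximations has the same measure; a set squeezed between two such sets belongs to the
  completion.
\<close>

theorem closed_projection_sets_completion:
  fixes F :: "('a::metric_space \<times> 'b::polish_space) set"
  assumes F: "closed F" and fin: "finite_measure \<nu>" and sets: "sets \<nu> = sets borel"
  shows "fst ` F \<in> sets (completion \<nu>)"
proof -
  interpret finite_measure \<nu> by fact
  have sp: "space \<nu> = UNIV" using sets_eq_imp_space_eq[OF sets] by simp
  let ?A = "fst ` F"
  obtain C where C: "C \<in> sets \<nu>" "?A \<subseteq> C" "outer_measure_of \<nu> ?A = emeasure \<nu> C"
    using outer_measure_of_attain[of ?A \<nu>] unfolding sp by blast
  have Cfin: "emeasure \<nu> C < \<infinity>" using emeasure_finite[of C] by (simp add: less_top[symmetric])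
  obtain B where B: "B \<in> sets \<nu>" "B \<subseteq> ?A" "emeasure \<nu> B = emeasure \<nu> C"
  proof (cases "emeasure \<nu> C = 0")
    case True then show ?thesis using that[of "{}"] by simp
  next
    case False
    then have "0 < emeasure \<nu> C" by (simp add: zero_less_iff_neq_zero)
    then obtain u where u: "\<And>n::nat. u n < emeasure \<nu> C" "u \<longlonglongrightarrow> emeasure \<nu> C"
      using ennreal_approx_unit Cfin
      by (metis approx_from_below_dense_linorder)
    have "\<exists>B\<in>sets \<nu>. B \<subseteq> ?A \<and> u n \<le> emeasure \<nu> B" for n
      using closed_projection_inner_approximation[OF F fin sets] u(1) C(3) by simp
    then obtain B where B: "\<And>n. B n \<in> sets \<nu>" "\<And>n. B n \<subseteq> ?A" "\<And>n. u n \<le> emeasure \<nu> (B n)"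
      by metis
    have "emeasure \<nu> C \<le> emeasure \<nu> (\<Union>n. B n)"
    proof (rule LIMSEQ_le_const2[OF u(2)])
      show "\<exists>N. \<forall>n\<ge>N. u n \<le> emeasure \<nu> (\<Union>n. B n)"
        using B by (intro exI[of _ 0] allI impI order_trans[OF B(3)] emeasure_mono) auto
    qed
    moreover have "emeasure \<nu> (\<Union>n. B n) \<le> emeasure \<nu> C"
      using B(2) C(1,2) by (intro emeasure_mono UN_least) blast+
    ultimately show ?thesis using B by (intro that[of "\<Union>n. B n"]) auto
  qed
  show ?thesis
  proof (rule completion.complete_sets_sandwich)
    show "B \<in> sets (completion \<nu>)" "C \<in> sets (completion \<nu>)" "B \<subseteq> ?A" "?A \<subseteq> C"
      using B(1,2) C(1,2) by simp_all
    show "emeasure (completion \<nu>) B = emeasure (completion \<nu>) C"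
        "emeasure (completion \<nu>) B < \<infinity>"
      using B(1,3) C(1) Cfin by simp_all
  qed
qed

section \<open>Measurable selections\<close>

text \<open>
  The selected point is the limit of a greedy search: at stage \<open>n\<close> the current closed set of
  candidates for \<open>x\<close> is cut down to the first ball of radius \<open>(1/2)^n\<close>, in a fixed enumeration, in
  which a candidate from the fibre of \<open>F\<close> over \<open>x\<close> survives.  Every decision of the search asks
  whether \<open>x\<close> lies in the projection of a closed set, and is therefore measurable for the completed measure.
\<close>

theorem closed_measurable_selection:
  fixes F :: "('a::metric_space \<times> 'b::polish_space) set"
  assumes F: "closed F" and fin: "finite_measure \<nu>" and sets: "sets \<nu> = sets borel"
  shows "\<exists>s \<in> completion \<nu> \<rightarrow>\<^sub>M borel. \<forall>x \<in> fst ` F. (x, s x) \<in> F"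
proof -
  have sp: "space \<nu> = UNIV" using sets_eq_imp_space_eq[OF sets] by simp
  obtain d :: "nat \<Rightarrow> 'b" where d: "\<And>y e. e > 0 \<Longrightarrow> \<exists>n. dist (d n) y < e"
    using dense_sequence[where 'b='b] by blast
  define meets where "meets x D \<longleftrightarrow> (\<exists>y\<in>D. (x, y) \<in> F)" for x D
  (* where no ball meets the fibre, LEAST is an arbitrary but fixed index, so pick stays measurable *)
  define pick where "pick n x D = (LEAST i. meets x (D \<inter> cball (d i) ((1/2)^n)))" for n :: nat and x D
  define C where "C x = rec_nat UNIV (\<lambda>n D. D \<inter> cball (d (pick n x D)) ((1/2)^n))" for x
  have C0: "C x 0 = UNIV" and CSuc: "C x (Suc n) = C x n \<inter> cball (d (pick n x (C x n))) ((1/2)^n)" for x n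
    by (simp_all add: C_def)
  have meas: "Measurable.pred (completion \<nu>) (\<lambda>x. meets x (C x n \<inter> D))"
    if "closed D" for D n
    using that
  proof (induction n arbitrary: D)
    case 0
    have "closed (F \<inter> UNIV \<times> D)" using F 0 by (intro closed_Int closed_Times) auto
    then have "fst ` (F \<inter> UNIV \<times> D) \<in> sets (completion \<nu>)"
      by (rule closed_projection_sets_completion[OF _ fin sets])
    moreover have "fst ` (F \<inter> UNIV \<times> D) = {x \<in> space (completion \<nu>). meets x (C x 0 \<inter> D)}"
      by (force simp: sp C0 meets_def)
    ultimately show ?case by (simp add: pred_def)
  next
    case (Suc n)
    have [measurable]: "(\<lambda>x. pick n x (C x n)) \<in> completion \<nu> \<rightarrow>\<^sub>M count_space UNIV"
      unfolding pick_def by (intro measurable_Least Suc.IH closed_cball)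
    have IH: "Measurable.pred (completion \<nu>) (\<lambda>x. meets x (C x n \<inter> (cball (d i) ((1/2)^n) \<inter> D)))" for i
      by (intro Suc.IH closed_Int closed_cball Suc.prems)
    show ?case
      unfolding CSuc Int_assoc
      by (rule measurable_compose_countable[where f="\<lambda>i x. meets x (C x n \<inter> (cball (d i) ((1/2)^n) \<inter> D))"])
        (use IH in measurable)
  qed
  define a where "a x n = d (pick n x (C x n))" for x n
  have domm: "Measurable.pred (completion \<nu>) (\<lambda>x. x \<in> fst ` F)"
    using closed_projection_sets_completion[OF F fin sets] by simp
  have am: "(\<lambda>x. if x \<in> fst ` F then a x n else d 0) \<in> completion \<nu> \<rightarrow>\<^sub>M borel" for n
  proof -
    have [measurable]: "(\<lambda>x. pick n x (C x n)) \<in> completion \<nu> \<rightarrow>\<^sub>M count_space UNIV"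
      unfolding pick_def by (intro measurable_Least meas closed_cball)
    have "(\<lambda>x. a x n) \<in> completion \<nu> \<rightarrow>\<^sub>M borel"
      unfolding a_def by (rule measurable_compose[where g=d and N="count_space UNIV"]) auto
    then show ?thesis using domm by (intro measurable_If) (auto simp: pred_def)
  qed
  have ex: "\<exists>y. a x \<longlonglongrightarrow> y \<and> (x, y) \<in> F" if x: "x \<in> fst ` F" for x
  proof -
    have ne: "meets x (C x n)" for n
    proof (induction n)
      case 0 then show ?case using x by (auto simp: C0 meets_def)
    next
      case (Suc n)
      then obtain y where y: "y \<in> C x n" "(x, y) \<in> F" by (auto simp: meets_def)
      obtain i where "dist (d i) y < (1/2)^n" using d[of "(1/2)^n" y] by auto
      with y have "meets x (C x n \<inter> cball (d i) ((1/2)^n))" by (auto simp: meets_def intro!: bexI[of _ y])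
      then show ?case unfolding CSuc pick_def by (rule LeastI)
    qed
    then have "\<forall>n. \<exists>y. y \<in> C x n \<and> (x, y) \<in> F" by (auto simp: meets_def)
    then obtain p where p: "\<And>n. p n \<in> C x n" "\<And>n. (x, p n) \<in> F" by metis
    have dec: "decseq (C x)" by (rule decseq_SucI) (simp add: CSuc)
    have close: "dist (a x n) (p m) \<le> (1/2)^n" if "m > n" for m n
    proof -
      have "p m \<in> C x (Suc n)" using p(1)[of m] decseqD[OF dec, of "Suc n" m] that by auto
      then show ?thesis by (simp add: CSuc a_def)
    qed
    have "Cauchy p"
      unfolding Cauchy_altdef2
    proof (intro allI impI)
      fix e :: real assume "e > 0"
      then obtain n where n: "(1/2)^n < e/2" using real_arch_pow_inv[of "e/2" "1/2"] by auto
      have "dist (p m) (p (Suc n)) < e" if "m \<ge> Suc n" for m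
        using dist_triangle3[of "p m" "p (Suc n)" "a x n"] close[of n m] close[of n "Suc n"] n that by simp
      then show "\<exists>N. \<forall>m\<ge>N. dist (p m) (p N) < e" by blast
    qed
    then obtain y where y: "p \<longlonglongrightarrow> y" using Cauchy_convergent convergent_def by blast
    have "(\<lambda>n. (x, p n)) \<longlonglongrightarrow> (x, y)" by (intro tendsto_Pair tendsto_const y)
    then have "(x, y) \<in> F" by (rule closed_sequentially[OF F p(2)])
    moreover have "a x \<longlonglongrightarrow> y"
    proof (rule tendsto_dist_iff[THEN iffD2], rule tendsto_sandwich)
      show "\<forall>\<^sub>F n in sequentially. 0 \<le> dist (a x n) y" by simp
      show "\<forall>\<^sub>F n in sequentially. dist (a x n) y \<le> (1/2)^n"
      proof (intro always_eventually allI)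
        fix n
        have "(\<lambda>m. dist (a x n) (p m)) \<longlonglongrightarrow> dist (a x n) y" by (intro tendsto_intros y)
        then show "dist (a x n) y \<le> (1/2)^n"
          by (rule LIMSEQ_le_const2) (auto intro!: exI[of _ "Suc n"] close)
      qed
      show "(\<lambda>n. (1/2)^n :: real) \<longlonglongrightarrow> 0" by (rule LIMSEQ_power_zero) simp
    qed simp
    ultimately show ?thesis by blast
  qed
  then obtain y where y: "\<And>x. x \<in> fst ` F \<Longrightarrow> a x \<longlonglongrightarrow> y x" "\<And>x. x \<in> fst ` F \<Longrightarrow> (x, y x) \<in> F"
    by metis
  (* a constant value off the projection keeps the limit measurable on the whole space *)
  define s where "s x = (if x \<in> fst ` F then y x else d 0)" for x
  have "s \<in> completion \<nu> \<rightarrow>\<^sub>M borel"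
  proof (rule borel_measurable_LIMSEQ_metric[OF am])
    show "(\<lambda>n. if x \<in> fst ` F then a x n else d 0) \<longlonglongrightarrow> s x" for x
      using y(1)[of x] by (simp add: s_def)
  qed
  moreover have "\<forall>x \<in> fst ` F. (x, s x) \<in> F" using y(2) by (simp add: s_def)
  ultimately show ?thesis by blast
qed

section \<open>Countable suprema of upper semicontinuous functions\<close>

lemma upper_semicontinuous_add:
  assumes "upper_semicontinuous g" "upper_semicontinuous h"
  shows "upper_semicontinuous (\<lambda>x. g x + h x)"
  unfolding upper_semicontinuous_def
proof
  fix a :: real
  have "{x. g x + h x < a} = (\<Union>q\<in>UNIV. {x. g x < q} \<inter> {x. h x < a - q})"
  proof (intro set_eqI iffI)
    fix x assume "x \<in> {x. g x + h x < a}"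
    then have "g x < (g x + (a - h x)) / 2" "h x < a - (g x + (a - h x)) / 2" by (auto simp: field_simps)
    then show "x \<in> (\<Union>q\<in>UNIV. {x. g x < q} \<inter> {x. h x < a - q})" by blast
  qed auto
  also have "open \<dots>" using assms unfolding upper_semicontinuous_def by (intro open_UN ballI open_Int) auto
  finally show "open {x. g x + h x < a}" .
qed

lemma upper_semicontinuous_uminus_scaled:
  assumes g: "lower_semicontinuous g" and l: "0 \<le> l"
  shows "upper_semicontinuous (\<lambda>x. - (l * g x))"
  unfolding upper_semicontinuous_def
proof
  fix a :: real
  show "open {x. - (l * g x) < a}"
  proof (cases "l = 0")
    case False
    with l have "{x. - (l * g x) < a} = {x. - a / l < g x}" by (auto simp: field_simps)
    then show ?thesis using g by (simp add: lower_semicontinuous_def)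
  qed simp
qed

lemma upper_semicontinuous_snd:
  assumes "upper_semicontinuous g"
  shows "upper_semicontinuous (\<lambda>p. g (snd p))"
  using assms open_vimage_snd unfolding upper_semicontinuous_def vimage_def by fastforce

lemma upper_semicontinuous_borel_measurable:
  "upper_semicontinuous g \<Longrightarrow> g \<in> borel_measurable borel"
  unfolding upper_semicontinuous_def by (intro borel_measurableI_less) simp

lemma lower_semicontinuous_borel_measurable:
  "lower_semicontinuous g \<Longrightarrow> g \<in> borel_measurable borel"
  unfolding lower_semicontinuous_def by (intro borel_measurableI_greater) simp

lemma closed_superlevel_upper_semicontinuous:
  assumes "upper_semicontinuous g"
  shows "closed {x. a \<le> g x}"
proof -
  have "{x. a \<le> g x} = - {x. g x < a}" by auto
  then show ?thesis using assms by (simp add: upper_semicontinuous_def closed_def)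
qed

text \<open>
  For each rational \<open>q\<close> a selection from the closed set \<open>{p. q \<le> h p}\<close> reaches the level \<open>q\<close> wherever
  this is possible, so these countably many selections together exhaust the supremum.
\<close>

lemma countable_maximizing_selections:
  fixes h :: "'a::metric_space \<times> 'b::polish_space \<Rightarrow> real"
  assumes h: "upper_semicontinuous h" and fin: "finite_measure \<nu>" and sets: "sets \<nu> = sets borel"
  shows "\<exists>y. (\<forall>n::nat. y n \<in> completion \<nu> \<rightarrow>\<^sub>M borel) \<and>
    (\<forall>x. (SUP z. ereal (h (x, z))) = (SUP n. ereal (h (x, y n x))))"
proof -
  let ?F = "\<lambda>q::rat. {p. of_rat q \<le> h p}"
  have "\<exists>s. s \<in> completion \<nu> \<rightarrow>\<^sub>M borel \<and> (\<forall>x \<in> fst ` ?F q. (x, s x) \<in> ?F q)" for q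
    using closed_measurable_selection[OF closed_superlevel_upper_semicontinuous[OF h] fin sets]
    by (auto simp: Bex_def)
  then obtain s where s: "\<And>q. s q \<in> completion \<nu> \<rightarrow>\<^sub>M borel"
      "\<And>q x. x \<in> fst ` ?F q \<Longrightarrow> (x, s q x) \<in> ?F q"
    by metis
  define y where "y n = s (from_nat n)" for n :: nat
  have "(SUP z. ereal (h (x, z))) = (SUP n. ereal (h (x, y n x)))" for x
  proof (rule antisym)
    show "(SUP n. ereal (h (x, y n x))) \<le> (SUP z. ereal (h (x, z)))"
      by (intro SUP_least SUP_upper) simp
    show "(SUP z. ereal (h (x, z))) \<le> (SUP n. ereal (h (x, y n x)))"
    proof (rule SUP_least, rule ccontr)
      fix z assume "\<not> ereal (h (x, z)) \<le> (SUP n. ereal (h (x, y n x)))"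
      then obtain r where r: "(SUP n. ereal (h (x, y n x))) < ereal r" "r < h (x, z)"
        using ereal_dense2[of "SUP n. ereal (h (x, y n x))" "ereal (h (x, z))"] by (auto simp: not_le)
      obtain q where q: "r < of_rat q" "of_rat q < h (x, z)" using of_rat_dense[OF r(2)] by blast
      have "x \<in> fst ` ?F q" using q(2) by (intro image_eqI[of _ _ "(x, z)"]) auto
      then have "ereal r < ereal (h (x, y (to_nat q) x))" using s(2)[of x q] q(1) by (simp add: y_def)
      also have "\<dots> \<le> (SUP n. ereal (h (x, y n x)))"
        by (rule SUP_upper) simp
      finally show False using r(1) by simp
    qed
  qed
  then show ?thesis using s(1) by (intro exI[of _ y]) (simp add: y_def)
qed

section \<open>Integrals of extended real functions\<close>

lemma ext_integral_cong_AE: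
  assumes "AE x in M. g x = h x"
  shows "ext_integral M g = ext_integral M h"
proof -
  have "(\<integral>\<^sup>+ x. e2ennreal (g x) \<partial>M) = (\<integral>\<^sup>+ x. e2ennreal (h x) \<partial>M)"
    using assms by (intro nn_integral_cong_AE) auto
  moreover have "(\<integral>\<^sup>+ x. e2ennreal (- g x) \<partial>M) = (\<integral>\<^sup>+ x. e2ennreal (- h x) \<partial>M)"
    using assms by (intro nn_integral_cong_AE) auto
  ultimately show ?thesis by (simp add: ext_integral_def)
qed

lemma ext_integral_integrable:
  assumes "integrable M g"
  shows "ext_integral M (\<lambda>x. ereal (g x)) = ereal (\<integral>x. g x \<partial>M)"
proof -
  have fin: "(\<integral>\<^sup>+ x. ennreal (g x) \<partial>M) < \<infinity>" "(\<integral>\<^sup>+ x. ennreal (- g x) \<partial>M) < \<infinity>"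
    using assms by (auto simp: real_integrable_def less_top[symmetric])
  then obtain p n where pn: "(\<integral>\<^sup>+ x. ennreal (g x) \<partial>M) = ennreal p" "0 \<le> p"
      "(\<integral>\<^sup>+ x. ennreal (- g x) \<partial>M) = ennreal n" "0 \<le> n"
    by (metis ennreal_cases infinity_ennreal_def less_irrefl)
  then show ?thesis
    by (simp add: ext_integral_def e2ennreal_ereal real_lebesgue_integral_def[OF assms])
qed

text \<open>
  Every dual function dominates the integrable function \<open>f\<close>, hence has the form \<open>f + u\<close> with
  \<open>u \<ge> 0\<close>.  In this form its extended integral is additive, whether or not the integral of \<open>u\<close>
  is finite.
\<close>

lemma ext_integral_add_nonneg:
  assumes g: "integrable M g" and u [measurable]: "u \<in> borel_measurable M"
  shows "ext_integral M (\<lambda>x. ereal (g x) + enn2ereal (u x)) = ereal (\<integral>x. g x \<partial>M) + enn2ereal (\<integral>\<^sup>+x. u x \<partial>M)"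
proof (cases "(\<integral>\<^sup>+x. u x \<partial>M) = \<infinity>")
  case True
  have [measurable]: "g \<in> borel_measurable M" using g by simp
  have gfin: "(\<integral>\<^sup>+ x. ennreal (- g x) \<partial>M) \<noteq> \<infinity>" using g by (simp add: real_integrable_def)
  have "u x \<le> e2ennreal (ereal (g x) + enn2ereal (u x)) + ennreal (- g x)" for x
  proof (cases "u x")
    case (real r)
    have "ennreal r \<le> ennreal (max 0 (g x + r) + max 0 (- g x))"
      by (intro ennreal_leI) auto
    also have "\<dots> = ennreal (g x + r) + ennreal (- g x)"
      by (simp only: ennreal_plus[OF max.cobounded1 max.cobounded1] ennreal_max_0)
    finally show ?thesis using real by (simp add: e2ennreal_ereal)
  next
    case top then show ?thesis by simp
  qed
  then have "(\<integral>\<^sup>+x. u x \<partial>M) \<le> (\<integral>\<^sup>+x. e2ennreal (ereal (g x) + enn2ereal (u x)) + ennreal (- g x) \<partial>M)"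
    by (intro nn_integral_mono)
  also have "\<dots> = (\<integral>\<^sup>+x. e2ennreal (ereal (g x) + enn2ereal (u x)) \<partial>M) + (\<integral>\<^sup>+x. ennreal (- g x) \<partial>M)"
    by (intro nn_integral_add) measurable
  finally have pos: "(\<integral>\<^sup>+x. e2ennreal (ereal (g x) + enn2ereal (u x)) \<partial>M) = \<infinity>"
    using True gfin by (auto simp: top_unique)
  have "(\<integral>\<^sup>+x. e2ennreal (- (ereal (g x) + enn2ereal (u x))) \<partial>M) \<le> (\<integral>\<^sup>+ x. ennreal (- g x) \<partial>M)"
  proof (intro nn_integral_mono)
    fix x
    have "ereal (g x) \<le> ereal (g x) + enn2ereal (u x)"
      using add_left_mono[OF enn2ereal_nonneg[of "u x"], of "ereal (g x)"] by simp
    then have "- (ereal (g x) + enn2ereal (u x)) \<le> - ereal (g x)" by (simp only: ereal_minus_le_minus)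
    then show "e2ennreal (- (ereal (g x) + enn2ereal (u x))) \<le> ennreal (- g x)"
      using e2ennreal_mono by (metis e2ennreal_ereal uminus_ereal.simps(1))
  qed
  with gfin have "(\<integral>\<^sup>+x. e2ennreal (- (ereal (g x) + enn2ereal (u x))) \<partial>M) \<noteq> \<infinity>" by (auto simp: top_unique)
  then obtain r where "(\<integral>\<^sup>+x. e2ennreal (- (ereal (g x) + enn2ereal (u x))) \<partial>M) = ennreal r" "0 \<le> r"
    by (metis ennreal_cases infinity_ennreal_def)
  then show ?thesis using pos True by (simp add: ext_integral_def)
next
  case False
  have fin: "AE x in M. u x \<noteq> \<infinity>" using False by (intro nn_integral_noteq_infinite) auto
  define r where "r x = enn2real (u x)" for x
  have [measurable]: "r \<in> borel_measurable M" unfolding r_def by simp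
  have ur: "AE x in M. u x = ennreal (r x)"
    using fin by eventually_elim (simp add: r_def less_top)
  then have nur: "(\<integral>\<^sup>+x. u x \<partial>M) = (\<integral>\<^sup>+x. ennreal (r x) \<partial>M)" by (rule nn_integral_cong_AE)
  have r0: "0 \<le> r x" for x by (simp add: r_def)
  have ri: "integrable M r" using False nur r0 by (intro integrableI_nonneg) (auto simp: less_top)
  have "ext_integral M (\<lambda>x. ereal (g x) + enn2ereal (u x)) = ext_integral M (\<lambda>x. ereal (g x + r x))"
  proof (rule ext_integral_cong_AE)
    show "AE x in M. ereal (g x) + enn2ereal (u x) = ereal (g x + r x)"
      using ur by eventually_elim (simp add: r0)
  qed
  also have "\<dots> = ereal (\<integral>x. g x + r x \<partial>M)" using g ri by (intro ext_integral_integrable) simp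
  also have "\<dots> = ereal (\<integral>x. g x \<partial>M) + ereal (\<integral>x. r x \<partial>M)" using g ri by simp
  also have "ereal (\<integral>x. r x \<partial>M) = enn2ereal (\<integral>\<^sup>+x. u x \<partial>M)"
    unfolding nur using ri r0 by (simp add: nn_integral_eq_integral)
  finally show ?thesis .
qed

section \<open>The dual function phi\<close>

text \<open>
  The budget is left out: plans, attainable pairs and \<open>phi\<close> do not depend on it.
\<close>

locale transport_problem =
  fixes \<mu> :: "'a::polish_space measure" and c :: "'a \<Rightarrow> 'a \<Rightarrow> real" and f :: "'a \<Rightarrow> real"
  assumes \<mu>: "\<mu> \<in> borel_prob_measures"
    and c_nonneg: "\<And>x y. 0 \<le> c x y"
    and c_lsc: "lower_semicontinuous (\<lambda>(x, y). c x y)"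
    and c_refl: "\<And>x. c x x = 0"
    and f_usc: "upper_semicontinuous f"
    and f_integrable: "integrable \<mu> f"
begin

lemma sets_\<mu> [measurable_cong, simp]: "sets \<mu> = sets borel"
  using \<mu> by (simp add: borel_prob_measures_def)

lemma space_\<mu> [simp]: "space \<mu> = UNIV"
  using sets_eq_imp_space_eq[OF sets_\<mu>] by simp

lemma prob_space_\<mu>: "prob_space \<mu>"
  using \<mu> by (simp add: borel_prob_measures_def)

lemma f_measurable [measurable]: "f \<in> borel_measurable borel"
  by (rule upper_semicontinuous_borel_measurable[OF f_usc])

lemma c_measurable [measurable]: "(\<lambda>p. c (fst p) (snd p)) \<in> borel_measurable borel"
  using lower_semicontinuous_borel_measurable[OF c_lsc] by (simp add: case_prod_beta')

lemma measurable_graph: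
  assumes "sets \<nu> = sets borel" "z \<in> completion \<nu> \<rightarrow>\<^sub>M borel"
  shows "(\<lambda>x. (x, z x)) \<in> completion \<nu> \<rightarrow>\<^sub>M (borel :: ('a \<times> 'a) measure)"
proof -
  have "(\<lambda>x. x) \<in> completion \<nu> \<rightarrow>\<^sub>M borel"
    using assms(1) by (intro measurable_completion measurable_ident_sets)
  then have "(\<lambda>x. (x, z x)) \<in> completion \<nu> \<rightarrow>\<^sub>M borel \<Otimes>\<^sub>M borel"
    using assms(2) by (rule measurable_Pair)
  then show ?thesis by (simp add: borel_prod)
qed

lemma gain_upper_semicontinuous:
  "0 \<le> l \<Longrightarrow> upper_semicontinuous (\<lambda>p. f (snd p) - l * c (fst p) (snd p))"
  using upper_semicontinuous_add[OF upper_semicontinuous_snd[OF f_usc] upper_semicontinuous_uminus_scaled[OF c_lsc]]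
  by (simp add: case_prod_beta')

lemma gain_measurable:
  "0 \<le> l \<Longrightarrow> (\<lambda>p. f (snd p) - l * c (fst p) (snd p)) \<in> borel_measurable borel"
  by (intro upper_semicontinuous_borel_measurable gain_upper_semicontinuous)

lemma phi_maximizing_selections:
  assumes "0 \<le> l" "\<nu> \<in> borel_prob_measures"
  shows "\<exists>y. (\<forall>n::nat. y n \<in> completion \<nu> \<rightarrow>\<^sub>M borel) \<and>
    (\<forall>x. phi c f l x = (SUP n. ereal (f (y n x) - l * c x (y n x))))"
  using countable_maximizing_selections[OF gain_upper_semicontinuous[OF assms(1)], of \<nu>] assms(2)
  by (simp add: borel_prob_measures_def prob_space.finite_measure phi_def)

lemma phi_universally_measurable:
  assumes l: "0 \<le> l"
  shows "phi c f l \<in> borel_measurable universal_algebra"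
proof -
  have "phi c f l \<in> borel_measurable (completion \<nu>)" if \<nu>: "\<nu> \<in> borel_prob_measures" for \<nu>
  proof -
    obtain y where y: "\<And>n::nat. y n \<in> completion \<nu> \<rightarrow>\<^sub>M borel"
        "\<And>x. phi c f l x = (SUP n. ereal (f (y n x) - l * c x (y n x)))"
      using phi_maximizing_selections[OF l \<nu>] by blast
    have s\<nu>: "sets \<nu> = sets borel" using \<nu> by (simp add: borel_prob_measures_def)
    have "(\<lambda>x. f (y n x) - l * c x (y n x)) \<in> borel_measurable (completion \<nu>)" for n
      using measurable_compose[OF measurable_graph[OF s\<nu> y(1)] gain_measurable[OF l]] by simp
    then show ?thesis unfolding y(2) by simp
  qed
  moreover have "space (completion \<nu>) = UNIV" if "\<nu> \<in> borel_prob_measures" for \<nu> :: "'a measure"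
    using that sets_eq_imp_space_eq[of \<nu> borel] by (simp add: borel_prob_measures_def)
  ultimately show ?thesis
    unfolding measurable_def by (simp add: sets_universal_algebra)
qed

lemma phi_ge: "ereal (f y - l * c x y) \<le> phi c f l x"
  unfolding phi_def by (rule SUP_upper) simp

lemma phi_dual_feasible: "(l, phi c f l) \<in> dual_feasible c f \<longleftrightarrow> 0 \<le> l"
proof -
  have "ereal (f y) \<le> phi c f l x + ereal (l * c x y)" for x y
    using phi_ge[of y l x] by (cases "phi c f l x") auto
  then show ?thesis by (auto simp: dual_feasible_def phi_universally_measurable)
qed

text \<open>
  The sequence starts at \<open>z 0 x = x\<close>, where the gain is \<open>f x\<close>, and moves to a new candidate only where
  this strictly increases the gain, which makes the gains monotone and bounds them from below by the
  integrable function \<open>f\<close>.  A candidate is admitted only up to a cutoff on its cost and on the value of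
  \<open>f\<close> there, which makes cost and value integrable at each stage; every selection occurs with every
  cutoff, so the supremum is not affected.
\<close>

lemma phi_monotone_maximizing_sequence:
  assumes l: "0 \<le> l"
  shows "\<exists>z N. (\<forall>k::nat. z k \<in> completion \<mu> \<rightarrow>\<^sub>M borel) \<and>
    (\<forall>k x. c x (z k x) \<le> N k \<and> f x \<le> f (z k x) - l * c x (z k x) \<and> f (z k x) \<le> max (N k) (f x)) \<and>
    (\<forall>x. incseq (\<lambda>k. f (z k x) - l * c x (z k x))) \<and>
    (\<forall>x. phi c f l x = (SUP k. ereal (f (z k x) - l * c x (z k x))))"
proof -
  obtain y where ym: "\<And>n::nat. y n \<in> completion \<mu> \<rightarrow>\<^sub>M borel"
      and y: "\<And>x. phi c f l x = (SUP n. ereal (f (y n x) - l * c x (y n x)))"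
    using phi_maximizing_selections[OF l \<mu>] by blast
  define h where "h x v = f v - l * c x v" for x v
  define w where "w n m x = (if c x (y n x) \<le> real m \<and> f (y n x) \<le> real m then y n x else x)"
    for n m :: nat and x
  define cand where "cand k = (case prod_decode k of (n, m) \<Rightarrow> w n m)" for k
  define z where "z = rec_nat (\<lambda>x. x) (\<lambda>k g x. if h x (g x) < h x (cand k x) then cand k x else g x)"
  have z0: "z 0 = (\<lambda>x. x)" and zSuc: "z (Suc k) = (\<lambda>x. if h x (z k x) < h x (cand k x) then cand k x else z k x)" for k
    by (simp_all add: z_def fun_eq_iff)
  have idm [measurable]: "(\<lambda>x. x) \<in> completion \<mu> \<rightarrow>\<^sub>M borel"
    by (intro measurable_completion measurable_ident_sets) simp
  have comp: "(\<lambda>x. k (x, v x)) \<in> borel_measurable (completion \<mu>)"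
    if "v \<in> completion \<mu> \<rightarrow>\<^sub>M borel" "k \<in> borel_measurable borel" for k :: "'a \<times> 'a \<Rightarrow> real" and v
    by (rule measurable_compose[OF measurable_graph[OF sets_\<mu> that(1)] that(2)])
  have hm: "(\<lambda>x. h x (v x)) \<in> borel_measurable (completion \<mu>)" if "v \<in> completion \<mu> \<rightarrow>\<^sub>M borel" for v
    using comp[OF that gain_measurable[OF l]] by (simp add: h_def)
  have cm: "(\<lambda>x. c x (v x)) \<in> borel_measurable (completion \<mu>)" if "v \<in> completion \<mu> \<rightarrow>\<^sub>M borel" for v
    using comp[OF that c_measurable] by simp
  have wm: "w n m \<in> completion \<mu> \<rightarrow>\<^sub>M borel" for n m
    unfolding w_def using cm[OF ym[of n]] measurable_compose[OF ym[of n] f_measurable] ym[of n] idm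
    by measurable
  have candm: "cand k \<in> completion \<mu> \<rightarrow>\<^sub>M borel" for k
    unfolding cand_def using wm by (simp split: prod.split)
  have zm: "z k \<in> completion \<mu> \<rightarrow>\<^sub>M borel" for k
  proof (induction k)
    case (Suc k)
    show ?case unfolding zSuc using hm[OF Suc] hm[OF candm[of k]] candm[of k] Suc by measurable
  qed (simp add: z0)
  have hz: "f x \<le> h x (z k x)" for k x
  proof (induction k)
    case (Suc k) then show ?case by (auto simp: zSuc)
  qed (simp add: z0 h_def c_refl)
  have wb: "c x (w n m x) \<le> real m \<and> f (w n m x) \<le> max (real m) (f x)" for n m x
    by (auto simp: w_def c_refl)
  have "\<exists>N. \<forall>x. c x (z k x) \<le> N \<and> f (z k x) \<le> max N (f x)" for k
  proof (induction k)
    case 0 show ?case by (intro exI[of _ 0]) (simp add: z0 c_refl)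
  next
    case (Suc k)
    then obtain N where N: "\<And>x. c x (z k x) \<le> N" "\<And>x. f (z k x) \<le> max N (f x)" by blast
    obtain n m where "prod_decode k = (n, m)" by (cases "prod_decode k")
    then have nm: "cand k = w n m" by (simp add: cand_def)
    have "c x (z (Suc k) x) \<le> max N m \<and> f (z (Suc k) x) \<le> max (max N m) (f x)" for x
      using N[of x] wb[of x n m] unfolding zSuc nm by auto
    then show ?case by blast
  qed
  then obtain N where N: "\<And>k x. c x (z k x) \<le> N k \<and> f (z k x) \<le> max (N k) (f x)" by metis
  have inc: "incseq (\<lambda>k. h x (z k x))" for x
    by (rule incseq_SucI) (simp add: zSuc)
  have "phi c f l x = (SUP k. ereal (h x (z k x)))" for x
  proof (rule antisym)
    show "(SUP k. ereal (h x (z k x))) \<le> phi c f l x"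
      by (intro SUP_least) (simp add: h_def phi_ge)
    show "phi c f l x \<le> (SUP k. ereal (h x (z k x)))"
      unfolding y
    proof (rule SUP_least)
      fix n
      obtain m :: nat where m: "max (c x (y n x)) (f (y n x)) \<le> real m" using real_arch_simple by blast
      let ?k = "prod_encode (n, m)"
      have "cand ?k x = y n x" using m by (simp add: cand_def w_def)
      then have "h x (y n x) \<le> h x (z (Suc ?k) x)" by (simp add: zSuc)
      then show "ereal (f (y n x) - l * c x (y n x)) \<le> (SUP k. ereal (h x (z k x)))"
        by (intro SUP_upper2[of "Suc ?k"]) (simp_all add: h_def)
    qed
  qed
  then show ?thesis using zm N hz inc unfolding h_def by (intro exI[of _ z] exI[of _ N]) blast
qed

end

section \<open>Transport plans and the duality gap\<close>

lemma borel_measurable_fst: "(fst :: 'a::second_countable_topology \<times> 'b::second_countable_topology \<Rightarrow> 'a) \<in> borel \<rightarrow>\<^sub>M borel"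
  by (intro borel_measurable_continuous_onI continuous_intros)

lemma borel_measurable_snd: "(snd :: 'a::second_countable_topology \<times> 'b::second_countable_topology \<Rightarrow> 'b) \<in> borel \<rightarrow>\<^sub>M borel"
  by (intro borel_measurable_continuous_onI continuous_intros)

lemma measurable_universal_algebra_completion:
  assumes "g \<in> universal_algebra \<rightarrow>\<^sub>M N" "\<nu> \<in> borel_prob_measures"
  shows "g \<in> completion \<nu> \<rightarrow>\<^sub>M N"
proof -
  have "space \<nu> = UNIV"
    using assms(2) sets_eq_imp_space_eq[of \<nu> borel] by (simp add: borel_prob_measures_def)
  then show ?thesis
    using assms unfolding measurable_def by (auto simp: sets_universal_algebra)
qed

context transport_problem
begin

definition plans :: "('a \<times> 'a) measure set" where
  "plans = {\<pi> \<in> borel_prob_measures. distr \<pi> borel fst = \<mu>}"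

abbreviation cost :: "('a \<times> 'a) measure \<Rightarrow> real" where
  "cost \<pi> \<equiv> \<integral>p. c (fst p) (snd p) \<partial>\<pi>"

text \<open>
  The second marginal is free, so only the first one constrains a plan.
\<close>

lemma UN_couplings_eq_plans: "(\<Union>\<nu>\<in>borel_prob_measures. couplings \<mu> \<nu>) = plans"
proof (intro set_eqI iffI)
  fix \<pi> assume \<pi>: "\<pi> \<in> plans"
  then have s: "sets \<pi> = sets borel" and p: "prob_space \<pi>" and m: "distr \<pi> borel fst = \<mu>"
    by (auto simp: plans_def borel_prob_measures_def)
  have "snd \<in> \<pi> \<rightarrow>\<^sub>M borel" using borel_measurable_snd s by (simp cong: measurable_cong_sets)
  then have "distr \<pi> borel snd \<in> borel_prob_measures"
    using prob_space.prob_space_distr[OF p] by (simp add: borel_prob_measures_def)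
  then show "\<pi> \<in> (\<Union>\<nu>\<in>borel_prob_measures. couplings \<mu> \<nu>)"
    using \<pi> by (auto simp: couplings_def plans_def)
qed (auto simp: couplings_def plans_def)

lemma sets_plan: "\<pi> \<in> plans \<Longrightarrow> sets \<pi> = sets borel"
  by (simp add: plans_def borel_prob_measures_def)

lemma plan_fst_measurable: "\<pi> \<in> plans \<Longrightarrow> fst \<in> \<pi> \<rightarrow>\<^sub>M borel"
  using borel_measurable_fst sets_plan by (simp cong: measurable_cong_sets)

lemma plan_snd_measurable: "\<pi> \<in> plans \<Longrightarrow> snd \<in> \<pi> \<rightarrow>\<^sub>M borel"
  using borel_measurable_snd sets_plan by (simp cong: measurable_cong_sets)

lemma plan_cost_measurable: "\<pi> \<in> plans \<Longrightarrow> (\<lambda>p. c (fst p) (snd p)) \<in> borel_measurable \<pi>"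
  using c_measurable sets_plan by (simp cong: measurable_cong_sets)

lemma distr_plan_fst: "\<pi> \<in> plans \<Longrightarrow> distr \<pi> borel fst = \<mu>"
  by (simp add: plans_def)

lemma plan_AE_fst:
  assumes "\<pi> \<in> plans" "AE x in \<mu>. P x"
  shows "AE p in \<pi>. P (fst p)"
proof (rule AE_distrD[OF plan_fst_measurable[OF assms(1)]])
  show "AE x in distr \<pi> borel fst. P x" using assms(2) unfolding distr_plan_fst[OF assms(1)] .
qed

lemma plan_nn_integral_fst:
  assumes "\<pi> \<in> plans" "u \<in> borel_measurable borel"
  shows "(\<integral>\<^sup>+p. u (fst p) \<partial>\<pi>) = (\<integral>\<^sup>+x. u x \<partial>\<mu>)"
  using nn_integral_distr[OF plan_fst_measurable[OF assms(1)], of u] assms by (simp add: distr_plan_fst)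

lemma plan_integral_fst:
  assumes "\<pi> \<in> plans"
  shows "integrable \<pi> (\<lambda>p. f (fst p))" "(\<integral>p. f (fst p) \<partial>\<pi>) = (\<integral>x. f x \<partial>\<mu>)"
  using integrable_distr_eq[OF plan_fst_measurable[OF assms(1)] f_measurable]
    integral_distr[OF plan_fst_measurable[OF assms(1)] f_measurable] f_integrable assms
  by (simp_all add: distr_plan_fst)

lemma transport_cost_eq:
  assumes \<pi>: "\<pi> \<in> plans" and c: "integrable \<pi> (\<lambda>p. c (fst p) (snd p))"
  shows "transport_cost c \<pi> = ereal (cost \<pi>)"
  using ext_integral_integrable[OF c] by (simp add: transport_cost_def case_prod_beta')

lemma primal_feasible_iff:
  "\<pi> \<in> primal_feasible c \<mu> \<delta> \<longleftrightarrow>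
    \<pi> \<in> plans \<and> integrable \<pi> (\<lambda>p. c (fst p) (snd p)) \<and> cost \<pi> \<le> \<delta>"
proof -
  have "integrable \<pi> (\<lambda>p. c (fst p) (snd p))"
    if \<pi>: "\<pi> \<in> plans" and le: "transport_cost c \<pi> \<le> ereal \<delta>"
  proof (rule integrableI_nonneg)
    have "transport_cost c \<pi> = enn2ereal (\<integral>\<^sup>+p. ennreal (c (fst p) (snd p)) \<partial>\<pi>)"
      by (simp add: transport_cost_def ext_integral_def case_prod_beta' c_nonneg ennreal_neg zero_ennreal.rep_eq)
    with le have "(\<integral>\<^sup>+p. ennreal (c (fst p) (snd p)) \<partial>\<pi>) \<noteq> \<infinity>" by auto
    then show "(\<integral>\<^sup>+p. ennreal (c (fst p) (snd p)) \<partial>\<pi>) < \<infinity>" by (simp add: less_top)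
  qed (use \<pi> in \<open>simp_all add: plan_cost_measurable c_nonneg\<close>)
  then show ?thesis
    unfolding primal_feasible_def UN_couplings_eq_plans by (auto simp: transport_cost_eq)
qed

lemma primal_objective_eq:
  assumes "integrable \<pi> (\<lambda>p. f (snd p))"
  shows "primal_objective f \<pi> = ereal (\<integral>p. f (snd p) \<partial>\<pi>)"
  using ext_integral_integrable[OF assms] by (simp add: primal_objective_def case_prod_beta')

lemma neg_part_integrable_iff:
  "neg_part_integrable f \<pi> \<longleftrightarrow> (\<integral>\<^sup>+p. ennreal (- f (snd p)) \<partial>\<pi>) < \<infinity>"
  by (simp add: neg_part_integrable_def case_prod_beta' max.commute[of _ 0])

text \<open>
  On dual feasible pairs the argument of \<^const>\<open>e2ennreal\<close> is nonnegative, so nothing is cut off.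
\<close>

definition slack :: "real \<Rightarrow> ('a \<Rightarrow> ereal) \<Rightarrow> 'a \<times> 'a \<Rightarrow> ennreal" where
  "slack l \<phi> p = e2ennreal (\<phi> (fst p) + ereal (l * c (fst p) (snd p) - f (snd p)))"

lemma dual_feasible_ge:
  assumes "(l, \<phi>) \<in> dual_feasible c f"
  shows "ereal (f x) \<le> \<phi> x"
  using assms c_refl[of x] unfolding dual_feasible_def by (auto dest!: spec[of _ x] simp: zero_ereal_def[symmetric])

text \<open>
  Pointwise, \<open>f y + slack = f x + u x + l * c x y\<close> where \<open>\<phi> = f + u\<close>.  Integrating over the plan gives
  the identity when \<open>f y\<close> is integrable.  Otherwise the positive part of \<open>f y\<close> has infinite integral,
  which forces \<open>u\<close> to have infinite integral, and both objectives are infinite.  As \<open>\<phi>\<close> is measurable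
  only for the completion of \<open>\<mu>\<close>, the slack agrees with a measurable function almost everywhere with
  respect to the plan; the second claim makes this available for reading off when the integral of the
  slack vanishes.
\<close>

lemma duality_gap:
  assumes \<pi>: "\<pi> \<in> plans" and c: "integrable \<pi> (\<lambda>p. c (fst p) (snd p))"
    and neg: "neg_part_integrable f \<pi>" and dual: "(l, \<phi>) \<in> dual_feasible c f"
  shows "dual_objective \<mu> \<delta> (l, \<phi>) =
    primal_objective f \<pi> + (enn2ereal (\<integral>\<^sup>+p. slack l \<phi> p \<partial>\<pi>) + ereal (l * (\<delta> - cost \<pi>)))"
    and "\<exists>s\<in>borel_measurable \<pi>. AE p in \<pi>. slack l \<phi> p = s p"
proof -
  have l: "0 \<le> l" using dual by (simp add: dual_feasible_def)
  have \<phi>m: "\<phi> \<in> borel_measurable (completion \<mu>)"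
    using dual \<mu> by (auto simp: dual_feasible_def intro: measurable_universal_algebra_completion)
  have f_compl: "f \<in> borel_measurable (completion \<mu>)"
    by (intro measurable_completion) simp
  define u where "u x = e2ennreal (\<phi> x - ereal (f x))" for x
  have \<phi>: "\<phi> x = ereal (f x) + enn2ereal (u x)" for x
    using dual_feasible_ge[OF dual, of x] unfolding u_def
    by (cases "\<phi> x") (auto simp: enn2ereal_e2ennreal)
  have um: "u \<in> borel_measurable (completion \<mu>)"
    unfolding u_def using \<phi>m f_compl by measurable
  have "ext_integral (completion \<mu>) \<phi> = ereal (\<integral>x. f x \<partial>completion \<mu>) + enn2ereal (\<integral>\<^sup>+x. u x \<partial>completion \<mu>)"
    unfolding \<phi>[abs_def] using f_integrable um by (intro ext_integral_add_nonneg) (simp_all add: integrable_completion)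
  then have J: "dual_objective \<mu> \<delta> (l, \<phi>) = ereal (l * \<delta>) + (ereal (\<integral>x. f x \<partial>\<mu>) + enn2ereal (\<integral>\<^sup>+x. u x \<partial>\<mu>))"
    by (simp add: dual_objective_def nn_integral_completion integral_completion)
  (* a Borel version of u, which can be composed with the first projection *)
  obtain v where v [measurable]: "v \<in> borel_measurable \<mu>" and uv: "AE x in \<mu>. u x = v x"
    using completion_ex_borel_measurable[OF um] by blast
  have [measurable]: "v \<in> borel_measurable borel" using v by (simp cong: measurable_cong_sets)
  note [measurable] = plan_fst_measurable[OF \<pi>] plan_snd_measurable[OF \<pi>] plan_cost_measurable[OF \<pi>]
  let ?U = "\<integral>\<^sup>+p. v (fst p) \<partial>\<pi>"
  have U: "(\<integral>\<^sup>+x. u x \<partial>\<mu>) = ?U"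
    using nn_integral_cong_AE[OF uv] plan_nn_integral_fst[OF \<pi>, of v] by simp
  have ae: "AE p in \<pi>. u (fst p) = v (fst p)" by (rule plan_AE_fst[OF \<pi> uv])
  define s where "s p = e2ennreal (ereal (f (fst p)) + enn2ereal (v (fst p)) + ereal (l * c (fst p) (snd p) - f (snd p)))" for p
  have sm [measurable]: "s \<in> borel_measurable \<pi>" unfolding s_def by measurable
  have slack_s: "AE p in \<pi>. slack l \<phi> p = s p"
    using ae by eventually_elim (simp add: slack_def s_def \<phi>)
  then show "\<exists>s\<in>borel_measurable \<pi>. AE p in \<pi>. slack l \<phi> p = s p" using sm by blast
  have S: "(\<integral>\<^sup>+p. slack l \<phi> p \<partial>\<pi>) = (\<integral>\<^sup>+p. s p \<partial>\<pi>)" by (rule nn_integral_cong_AE[OF slack_s])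
  have key: "ereal (f (snd p)) + enn2ereal (slack l \<phi> p) = ereal (f (fst p) + l * c (fst p) (snd p)) + enn2ereal (u (fst p))" for p
  proof -
    have "ereal (f (snd p)) \<le> \<phi> (fst p) + ereal (l * c (fst p) (snd p))"
      using dual by (auto simp: dual_feasible_def)
    then show ?thesis unfolding slack_def \<phi>
      by (cases "u (fst p)") (auto simp: enn2ereal_e2ennreal)
  qed
  have "ext_integral \<pi> (\<lambda>p. ereal (f (fst p) + l * c (fst p) (snd p)) + enn2ereal (v (fst p))) =
      ereal (\<integral>p. f (fst p) + l * c (fst p) (snd p) \<partial>\<pi>) + enn2ereal ?U"
    using plan_integral_fst[OF \<pi>] c by (intro ext_integral_add_nonneg) auto
  also have "(\<integral>p. f (fst p) + l * c (fst p) (snd p) \<partial>\<pi>) = (\<integral>x. f x \<partial>\<mu>) + l * cost \<pi>"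
    using plan_integral_fst[OF \<pi>] c by simp
  finally have R: "ext_integral \<pi> (\<lambda>p. ereal (f (fst p) + l * c (fst p) (snd p)) + enn2ereal (v (fst p))) =
      ereal ((\<integral>x. f x \<partial>\<mu>) + l * cost \<pi>) + enn2ereal ?U" .
  show "dual_objective \<mu> \<delta> (l, \<phi>) =
    primal_objective f \<pi> + (enn2ereal (\<integral>\<^sup>+p. slack l \<phi> p \<partial>\<pi>) + ereal (l * (\<delta> - cost \<pi>)))"
  proof (cases "integrable \<pi> (\<lambda>p. f (snd p))")
    case True
    have "ext_integral \<pi> (\<lambda>p. ereal (f (snd p)) + enn2ereal (s p)) =
        ereal (\<integral>p. f (snd p) \<partial>\<pi>) + enn2ereal (\<integral>\<^sup>+p. s p \<partial>\<pi>)"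
      by (rule ext_integral_add_nonneg[OF True sm])
    moreover have "ext_integral \<pi> (\<lambda>p. ereal (f (snd p)) + enn2ereal (s p)) =
        ext_integral \<pi> (\<lambda>p. ereal (f (fst p) + l * c (fst p) (snd p)) + enn2ereal (v (fst p)))"
    proof (rule ext_integral_cong_AE)
      show "AE p in \<pi>. ereal (f (snd p)) + enn2ereal (s p) =
          ereal (f (fst p) + l * c (fst p) (snd p)) + enn2ereal (v (fst p))"
        using slack_s ae by eventually_elim (use key in metis)
    qed
    ultimately have "ereal (\<integral>p. f (snd p) \<partial>\<pi>) + enn2ereal (\<integral>\<^sup>+p. s p \<partial>\<pi>) =
        ereal ((\<integral>x. f x \<partial>\<mu>) + l * cost \<pi>) + enn2ereal ?U"
      using R by simp
    then show ?thesis
      unfolding J U S primal_objective_eq[OF True]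
      by (cases "\<integral>\<^sup>+p. s p \<partial>\<pi>"; cases ?U) (auto simp: algebra_simps)
  next
    case False
    have neg': "(\<integral>\<^sup>+p. ennreal (- f (snd p)) \<partial>\<pi>) \<noteq> \<infinity>" using neg by (auto simp: neg_part_integrable_iff)
    with False have pos: "(\<integral>\<^sup>+p. ennreal (f (snd p)) \<partial>\<pi>) = \<infinity>" by (simp add: real_integrable_def)
    have I: "primal_objective f \<pi> = \<infinity>"
    proof -
      obtain r where "(\<integral>\<^sup>+p. ennreal (- f (snd p)) \<partial>\<pi>) = ennreal r" "0 \<le> r"
        using neg' by (cases "\<integral>\<^sup>+p. ennreal (- f (snd p)) \<partial>\<pi>") auto
      then show ?thesis using pos by (simp add: primal_objective_def ext_integral_def case_prod_beta')
    qed
    have "(\<integral>\<^sup>+p. ennreal (f (snd p)) \<partial>\<pi>) \<le>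
        (\<integral>\<^sup>+p. ennreal (f (fst p)) + ennreal (l * c (fst p) (snd p)) + v (fst p) \<partial>\<pi>)"
    proof (rule nn_integral_mono_AE)
      show "AE p in \<pi>. ennreal (f (snd p)) \<le> ennreal (f (fst p)) + ennreal (l * c (fst p) (snd p)) + v (fst p)"
        using ae
      proof eventually_elim
        case (elim p)
        have "ereal (f (snd p)) \<le> \<phi> (fst p) + ereal (l * c (fst p) (snd p))"
          using dual by (auto simp: dual_feasible_def)
        then have le: "ereal (f (snd p)) \<le> ereal (f (fst p)) + enn2ereal (u (fst p)) + ereal (l * c (fst p) (snd p))"
          by (simp add: \<phi>)
        show ?case unfolding elim[symmetric]
        proof (cases "u (fst p)")
          case (real r)
          have "ennreal (f (snd p)) \<le> ennreal (max 0 (f (fst p)) + l * c (fst p) (snd p) + r)"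
            using le real by (intro ennreal_leI) auto
          also have "\<dots> = ennreal (f (fst p)) + ennreal (l * c (fst p) (snd p)) + u (fst p)"
            using real l c_nonneg by (simp add: ennreal_plus)
          finally show "ennreal (f (snd p)) \<le> ennreal (f (fst p)) + ennreal (l * c (fst p) (snd p)) + u (fst p)" .
        qed simp
      qed
    qed
    also have "\<dots> = (\<integral>\<^sup>+p. ennreal (f (fst p)) \<partial>\<pi>) + (\<integral>\<^sup>+p. ennreal (l * c (fst p) (snd p)) \<partial>\<pi>) + ?U"
      by (simp add: nn_integral_add)
    finally have "\<infinity> \<le> (\<integral>\<^sup>+p. ennreal (f (fst p)) \<partial>\<pi>) + (\<integral>\<^sup>+p. ennreal (l * c (fst p) (snd p)) \<partial>\<pi>) + ?U"
      using pos by simp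
    moreover have "(\<integral>\<^sup>+p. ennreal (f (fst p)) \<partial>\<pi>) \<noteq> \<infinity>" "(\<integral>\<^sup>+p. ennreal (l * c (fst p) (snd p)) \<partial>\<pi>) \<noteq> \<infinity>"
      using real_integrable_def[THEN iffD1, OF plan_integral_fst(1)[OF \<pi>]]
        real_integrable_def[THEN iffD1, OF integrable_mult_right[OF c, of l]] by simp_all
    ultimately have "?U = \<infinity>" by (auto simp: top_unique)
    then show ?thesis unfolding J U I by (simp add: plus_ereal.simps)
  qed
qed

end

section \<open>Mixtures and supergradients\<close>

text \<open>
  Draw from \<open>M\<close> or \<open>N\<close> according to the toss of a biased coin.
\<close>

lemma probability_mixture:
  assumes M: "prob_space M" and N: "prob_space N" and sets: "sets N = sets M" and t: "0 \<le> t" "t \<le> 1"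
  shows "\<exists>P. prob_space P \<and> sets P = sets M \<and>
    (\<forall>g\<in>borel_measurable M. (\<integral>\<^sup>+x. g x \<partial>P) = ennreal t * (\<integral>\<^sup>+x. g x \<partial>M) + ennreal (1 - t) * (\<integral>\<^sup>+x. g x \<partial>N))"
proof -
  let ?k = "\<lambda>b. if b then M else N"
  let ?P = "measure_pmf (bernoulli_pmf t) \<bind> ?k"
  have k: "?k \<in> measure_pmf (bernoulli_pmf t) \<rightarrow>\<^sub>M subprob_algebra M"
    using M N sets by (auto simp: measurable_def space_subprob_algebra prob_space_imp_subprob_space)
  have "prob_space ?P"
    using M N by (intro prob_space.prob_space_bind[OF prob_space_measure_pmf _ k]) simp
  moreover have "sets ?P = sets M" using sets by (intro sets_bind) auto
  moreover have "(\<integral>\<^sup>+x. g x \<partial>?P) = ennreal t * (\<integral>\<^sup>+x. g x \<partial>M) + ennreal (1 - t) * (\<integral>\<^sup>+x. g x \<partial>N)"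
    if "g \<in> borel_measurable M" for g
    using t by (simp add: nn_integral_bind[OF that k] nn_integral_bernoulli_pmf mult.commute)
  ultimately show ?thesis by blast
qed

lemma integral_of_nn_integral_mixture:
  fixes g :: "'b \<Rightarrow> real"
  assumes P: "sets P = sets M"
    and mix: "\<And>h. h \<in> borel_measurable M \<Longrightarrow>
      (\<integral>\<^sup>+x. h x \<partial>P) = ennreal t * (\<integral>\<^sup>+x. h x \<partial>M) + ennreal (1 - t) * (\<integral>\<^sup>+x. h x \<partial>N)"
    and t: "0 \<le> t" "t \<le> 1" and gM: "integrable M g" and gN: "integrable N g"
  shows "integrable P g" "(\<integral>x. g x \<partial>P) = t * (\<integral>x. g x \<partial>M) + (1 - t) * (\<integral>x. g x \<partial>N)"
proof -
  have gm: "g \<in> borel_measurable M" using gM by simp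
  then have gP: "g \<in> borel_measurable P" using P by (simp cong: measurable_cong_sets)
  have fin: "(\<integral>\<^sup>+x. ennreal (g x) \<partial>M) \<noteq> \<infinity>" "(\<integral>\<^sup>+x. ennreal (- g x) \<partial>M) \<noteq> \<infinity>"
    "(\<integral>\<^sup>+x. ennreal (g x) \<partial>N) \<noteq> \<infinity>" "(\<integral>\<^sup>+x. ennreal (- g x) \<partial>N) \<noteq> \<infinity>"
    using gM gN by (simp_all add: real_integrable_def)
  have real: "\<exists>r. X = ennreal r \<and> 0 \<le> r" if "X \<noteq> \<infinity>" for X :: ennreal
    using that by (cases X) auto
  then obtain a b a' b' where ab:
    "(\<integral>\<^sup>+x. ennreal (g x) \<partial>M) = ennreal a" "0 \<le> a" "(\<integral>\<^sup>+x. ennreal (- g x) \<partial>M) = ennreal b" "0 \<le> b"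
    "(\<integral>\<^sup>+x. ennreal (g x) \<partial>N) = ennreal a'" "0 \<le> a'" "(\<integral>\<^sup>+x. ennreal (- g x) \<partial>N) = ennreal b'" "0 \<le> b'"
    using real[OF fin(1)] real[OF fin(2)] real[OF fin(3)] real[OF fin(4)] by blast
  have p: "(\<integral>\<^sup>+x. ennreal (g x) \<partial>P) = ennreal (t * a + (1 - t) * a')"
    using mix[of "\<lambda>x. ennreal (g x)"] gm t ab by (simp add: ennreal_mult ennreal_plus)
  have n: "(\<integral>\<^sup>+x. ennreal (- g x) \<partial>P) = ennreal (t * b + (1 - t) * b')"
    using mix[of "\<lambda>x. ennreal (- g x)"] gm t ab by (simp add: ennreal_mult ennreal_plus)
  show int: "integrable P g" using gP p n by (simp add: real_integrable_def)
  have "0 \<le> t * a + (1 - t) * a'" "0 \<le> t * b + (1 - t) * b'" using t ab by simp_all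
  then show "(\<integral>x. g x \<partial>P) = t * (\<integral>x. g x \<partial>M) + (1 - t) * (\<integral>x. g x \<partial>N)"
    using p n ab t
    by (simp add: real_lebesgue_integral_def[OF int] real_lebesgue_integral_def[OF gM] real_lebesgue_integral_def[OF gN] algebra_simps)
qed

text \<open>
  Chords from points left of \<open>\<delta>\<close> to points right of \<open>\<delta>\<close> pass at most at height \<open>I\<close> over \<open>\<delta>\<close>, so each slope
  from \<open>(\<delta>, I)\<close> to a point on the right is at most each slope from a point on the left.  The
  supremum of the former and \<open>0\<close> separates the two families; it is finite because \<open>(0, v0)\<close> lies on the left of \<open>\<delta>\<close>.
\<close>

lemma supergradient_at_interior_point:
  fixes G :: "(real \<times> real) set"
  assumes conv: "convex G" and origin: "(0, v0) \<in> G" and \<delta>: "0 < \<delta>"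
    and le: "\<And>k v. (k, v) \<in> G \<Longrightarrow> k \<le> \<delta> \<Longrightarrow> v \<le> I"
  shows "\<exists>l\<ge>0. \<forall>(k, v)\<in>G. v + l * (\<delta> - k) \<le> I"
proof -
  have cross: "(v - I) / (k - \<delta>) \<le> (I - v') / (\<delta> - k')"
    if kv: "(k, v) \<in> G" "\<delta> < k" and kv': "(k', v') \<in> G" "k' < \<delta>" for k v k' v'
  proof -
    (* the weight for which the chord crosses the budget exactly *)
    define t where "t = (\<delta> - k') / (k - k')"
    have t: "0 \<le> t" "t \<le> 1" using kv kv' by (auto simp: t_def field_simps)
    have "t *\<^sub>R (k, v) + (1 - t) *\<^sub>R (k', v') \<in> G"
      using convexD[OF conv kv(1) kv'(1), of t "1 - t"] t by simp
    moreover have tk: "t * k + (1 - t) * k' = \<delta>"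
    proof -
      have "t * (k - k') = \<delta> - k'" using kv kv' by (simp add: t_def)
      then show ?thesis by (simp add: algebra_simps)
    qed
    ultimately have "t * v + (1 - t) * v' \<le> I" using le[of \<delta> "t * v + (1 - t) * v'"] by simp
    then have "(k - k') * (t * v + (1 - t) * v') \<le> (k - k') * I"
      using kv kv' by (intro mult_left_mono) auto
    moreover have "(k - k') * (t * v + (1 - t) * v') = (\<delta> - k') * v + (k - \<delta>) * v'"
    proof -
      have "(k - k') * t = \<delta> - k'" using kv kv' by (simp add: t_def)
      moreover from this have "(k - k') * (1 - t) = k - \<delta>" by (simp add: algebra_simps)
      moreover have "(k - k') * (t * v + (1 - t) * v') = ((k - k') * t) * v + ((k - k') * (1 - t)) * v'"
        by (simp add: algebra_simps)
      ultimately show ?thesis by simp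
    qed
    ultimately show ?thesis using kv kv' by (simp add: divide_simps algebra_simps)
  qed
  (* inserting 0 makes the multiplier nonnegative and the set nonempty *)
  define Q where "Q = insert 0 {(v - I) / (k - \<delta>) | k v. (k, v) \<in> G \<and> \<delta> < k}"
  have ub: "q \<le> (I - v') / (\<delta> - k')" if "q \<in> Q" "(k', v') \<in> G" "k' < \<delta>" for q k' v'
    using that cross le[of k' v'] unfolding Q_def by auto
  have bdd: "bdd_above Q" using ub[OF _ origin] \<delta> by (auto intro!: bdd_aboveI)
  have ne: "Q \<noteq> {}" by (simp add: Q_def)
  define l where "l = Sup Q"
  have "0 \<le> l" unfolding l_def using bdd by (intro cSup_upper) (auto simp: Q_def)
  moreover have "v + l * (\<delta> - k) \<le> I" if kv: "(k, v) \<in> G" for k v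
  proof (cases k \<delta> rule: linorder_cases)
    case less
    have "l \<le> (I - v) / (\<delta> - k)" unfolding l_def using ub[OF _ kv less] ne by (intro cSup_least)
    then show ?thesis using less by (simp add: pos_le_divide_eq)
  next
    case equal then show ?thesis using le[OF kv] by simp
  next
    case greater
    have "(v - I) / (k - \<delta>) \<le> l" unfolding l_def using bdd kv greater by (intro cSup_upper) (auto simp: Q_def)
    then show ?thesis using greater by (simp add: pos_divide_le_eq algebra_simps)
  qed
  ultimately show ?thesis by blast
qed

context transport_problem
begin

definition attainable :: "(real \<times> real) set" where
  "attainable = {(cost \<pi>, \<integral>p. f (snd p) \<partial>\<pi>) | \<pi>.
     \<pi> \<in> plans \<and> integrable \<pi> (\<lambda>p. c (fst p) (snd p)) \<and> integrable \<pi> (\<lambda>p. f (snd p))}"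

lemma convex_attainable: "convex attainable"
  unfolding convex_alt
proof (intro ballI allI impI)
  fix a b and t :: real assume a: "a \<in> attainable" and b: "b \<in> attainable" and "0 \<le> t \<and> t \<le> 1"
  then have t: "0 \<le> 1 - t" "1 - t \<le> 1" by auto
  obtain M where M: "M \<in> plans" "integrable M (\<lambda>p. c (fst p) (snd p))" "integrable M (\<lambda>p. f (snd p))"
      "a = (cost M, \<integral>p. f (snd p) \<partial>M)"
    using a by (auto simp: attainable_def)
  obtain N where N: "N \<in> plans" "integrable N (\<lambda>p. c (fst p) (snd p))" "integrable N (\<lambda>p. f (snd p))"
      "b = (cost N, \<integral>p. f (snd p) \<partial>N)"
    using b by (auto simp: attainable_def)
  have "prob_space M" "prob_space N" "sets N = sets M"
    using M(1) N(1) by (auto simp: plans_def borel_prob_measures_def)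
  then obtain P where P: "prob_space P" "sets P = sets M"
    and mix: "\<And>g. g \<in> borel_measurable M \<Longrightarrow>
      (\<integral>\<^sup>+x. g x \<partial>P) = ennreal (1 - t) * (\<integral>\<^sup>+x. g x \<partial>M) + ennreal (1 - (1 - t)) * (\<integral>\<^sup>+x. g x \<partial>N)"
    using probability_mixture[OF _ _ _ t, of M N] by blast
  note sP = P(2)[unfolded sets_plan[OF M(1)]]
  have fstP: "fst \<in> P \<rightarrow>\<^sub>M borel"
    using borel_measurable_fst sP by (simp cong: measurable_cong_sets)
  have "distr P borel fst = \<mu>"
  proof (rule measure_eqI)
    fix A :: "'a set" assume "A \<in> sets (distr P borel fst)"
    then have A [measurable]: "A \<in> sets borel" by simp
    have i: "(\<lambda>p. indicator A (fst p) :: ennreal) \<in> borel_measurable M"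
      using plan_fst_measurable[OF M(1)] by (rule measurable_compose) simp
    have "emeasure (distr P borel fst) A = (\<integral>\<^sup>+x. indicator A x \<partial>distr P borel fst)" by simp
    also have "\<dots> = (\<integral>\<^sup>+p. indicator A (fst p) \<partial>P)" using fstP by (intro nn_integral_distr) simp_all
    also have "\<dots> = ennreal (1 - t) * (\<integral>\<^sup>+x. indicator A x \<partial>\<mu>) + ennreal (1 - (1 - t)) * (\<integral>\<^sup>+x. indicator A x \<partial>\<mu>)"
      using mix[OF i] plan_nn_integral_fst[OF M(1), of "indicator A"] plan_nn_integral_fst[OF N(1), of "indicator A"]
      by simp
    also have "\<dots> = (ennreal (1 - t) + ennreal (1 - (1 - t))) * emeasure \<mu> A"
      by (simp add: distrib_right)
    also have "ennreal (1 - t) + ennreal (1 - (1 - t)) = 1"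
      using t by (subst ennreal_plus[symmetric]) simp_all
    finally show "emeasure (distr P borel fst) A = emeasure \<mu> A" by simp
  qed simp
  then have "P \<in> plans" using P(1) sP by (simp add: plans_def borel_prob_measures_def)
  moreover note integral_of_nn_integral_mixture[OF P(2) mix t M(2) N(2)]
    integral_of_nn_integral_mixture[OF P(2) mix t M(3) N(3)]
  ultimately have "((1 - t) * cost M + t * cost N,
      (1 - t) * (\<integral>p. f (snd p) \<partial>M) + t * (\<integral>p. f (snd p) \<partial>N)) \<in> attainable"
    unfolding attainable_def by (auto intro!: exI[of _ P])
  then show "(1 - t) *\<^sub>R a + t *\<^sub>R b \<in> attainable" by (simp add: M(4) N(4))
qed

lemma attainable_le_primal_value:
  assumes "(k, v) \<in> attainable" "k \<le> \<delta>"
  shows "ereal v \<le> primal_value c f \<mu> \<delta>"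
proof -
  obtain \<pi> where \<pi>: "\<pi> \<in> plans" "integrable \<pi> (\<lambda>p. c (fst p) (snd p))" "integrable \<pi> (\<lambda>p. f (snd p))"
      "k = cost \<pi>" "v = (\<integral>p. f (snd p) \<partial>\<pi>)"
    using assms by (auto simp: attainable_def)
  have "neg_part_integrable f \<pi>"
    using \<pi>(3) by (simp add: neg_part_integrable_iff real_integrable_def less_top)
  moreover have "\<pi> \<in> primal_feasible c \<mu> \<delta>"
    unfolding primal_feasible_iff using \<pi> assms by simp
  ultimately have "primal_objective f \<pi> \<le> primal_value c f \<mu> \<delta>"
    unfolding primal_value_def by (intro SUP_upper) simp
  then show ?thesis by (simp add: primal_objective_eq[OF \<pi>(3)] \<pi>(5))
qed

text \<open>
  The plan that moves \<open>x\<close> to \<open>z x\<close> is the image of the completed \<open>\<mu>\<close> under \<open>x \<mapsto> (x, z x)\<close>, which is a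
  Borel measure even though \<open>z\<close> is measurable only for the completion.
\<close>

lemma graph_attainable:
  assumes z: "z \<in> completion \<mu> \<rightarrow>\<^sub>M borel"
    and cb: "\<And>x. c x (z x) \<le> N" and fb: "\<And>x. f x \<le> f (z x)" "\<And>x. f (z x) \<le> max N (f x)"
  shows "integrable (completion \<mu>) (\<lambda>x. c x (z x))" "integrable (completion \<mu>) (\<lambda>x. f (z x))"
    "((\<integral>x. c x (z x) \<partial>completion \<mu>), (\<integral>x. f (z x) \<partial>completion \<mu>)) \<in> attainable"
proof -
  interpret prob_space \<mu> by (rule prob_space_\<mu>)
  have em1: "emeasure (completion \<mu>) UNIV = 1" using emeasure_space_1 by simp
  interpret compl: prob_space "completion \<mu>" by (rule prob_spaceI) (simp add: em1)
  have g: "(\<lambda>x. (x, z x)) \<in> completion \<mu> \<rightarrow>\<^sub>M borel" by (rule measurable_graph[OF sets_\<mu> z])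
  have cm: "(\<lambda>x. c x (z x)) \<in> borel_measurable (completion \<mu>)"
    using measurable_compose[OF g c_measurable] by simp
  have fm: "(\<lambda>x. f (z x)) \<in> borel_measurable (completion \<mu>)"
    by (rule measurable_compose[OF z f_measurable])
  show ic: "integrable (completion \<mu>) (\<lambda>x. c x (z x))"
    using cb c_nonneg by (intro compl.integrable_const_bound[OF _ cm, of N]) simp
  have "integrable (completion \<mu>) f"
    using f_integrable by (subst integrable_completion) simp_all
  then have "integrable (completion \<mu>) (\<lambda>x. \<bar>N\<bar> + \<bar>f x\<bar>)" by simp
  then show if': "integrable (completion \<mu>) (\<lambda>x. f (z x))"
  proof (rule Bochner_Integration.integrable_bound[OF _ fm])
    have "\<bar>f (z x)\<bar> \<le> \<bar>N\<bar> + \<bar>f x\<bar>" for x using fb(1)[of x] fb(2)[of x] by (auto simp: max_def split: if_splits)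
    then show "AE x in completion \<mu>. norm (f (z x)) \<le> norm (\<bar>N\<bar> + \<bar>f x\<bar>)" by simp
  qed
  let ?\<pi> = "distr (completion \<mu>) borel (\<lambda>x. (x, z x))"
  have "distr ?\<pi> borel fst = distr (completion \<mu>) borel (\<lambda>x. x)"
    using distr_distr[OF borel_measurable_fst g] by (simp add: o_def)
  also have "\<dots> = distr \<mu> borel (\<lambda>x. x)" by (intro distr_completion measurable_ident_sets) simp
  also have "\<dots> = \<mu>" by (intro distr_id2) simp
  finally have "?\<pi> \<in> plans"
    using compl.prob_space_distr[OF g] by (simp add: plans_def borel_prob_measures_def)
  moreover have fs: "(\<lambda>p. f (snd p)) \<in> borel_measurable (borel :: ('a \<times> 'a) measure)"
    using borel_measurable_snd by (rule measurable_compose) simp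
  ultimately show "((\<integral>x. c x (z x) \<partial>completion \<mu>), (\<integral>x. f (z x) \<partial>completion \<mu>)) \<in> attainable"
    unfolding attainable_def using ic if'
    by (auto intro!: exI[of _ ?\<pi>] simp: integrable_distr_eq[OF g c_measurable] integrable_distr_eq[OF g fs]
      integral_distr[OF g c_measurable] integral_distr[OF g fs])
qed

lemma diagonal_attainable: "(0, \<integral>x. f x \<partial>\<mu>) \<in> attainable"
proof -
  have "(\<lambda>x. x) \<in> completion \<mu> \<rightarrow>\<^sub>M borel" by (intro measurable_completion measurable_ident_sets) simp
  from graph_attainable(3)[OF this, of 0] show ?thesis
    by (simp add: c_refl integral_completion)
qed

text \<open>
  Each member of the monotone maximizing sequence yields an attainable pair, so the integral of
  its gain is at most \<open>I - l * \<delta>\<close>; monotone convergence carries the bound over to \<open>phi\<close>.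
\<close>

lemma dual_objective_phi_le:
  assumes l: "0 \<le> l" and sup: "\<And>k v. (k, v) \<in> attainable \<Longrightarrow> v + l * (\<delta> - k) \<le> I"
  shows "dual_objective \<mu> \<delta> (l, phi c f l) \<le> ereal I"
proof -
  obtain z N where zm: "\<And>k::nat. z k \<in> completion \<mu> \<rightarrow>\<^sub>M borel"
    and zb: "\<And>k x. c x (z k x) \<le> N k" "\<And>k x. f x \<le> f (z k x) - l * c x (z k x)"
       "\<And>k x. f (z k x) \<le> max (N k) (f x)"
    and inc: "\<And>x. incseq (\<lambda>k. f (z k x) - l * c x (z k x))"
    and lim: "\<And>x. phi c f l x = (SUP k. ereal (f (z k x) - l * c x (z k x)))"
    using phi_monotone_maximizing_sequence[OF l] by blast
  let ?M = "completion \<mu>"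
  define h where "h k x = f (z k x) - l * c x (z k x)" for k x
  have fz: "f x \<le> f (z k x)" for k x
    using zb(2)[of x k] mult_nonneg_nonneg[OF l c_nonneg[of x "z k x"]] by linarith
  note att = graph_attainable[OF zm zb(1) fz zb(3)]
  have fi: "integrable ?M f" using f_integrable by (subst integrable_completion) simp_all
  have fc: "(\<integral>x. f x \<partial>?M) = (\<integral>x. f x \<partial>\<mu>)" by (rule integral_completion) simp
  have hi: "integrable ?M (h k)" for k unfolding h_def using att(1,2)[of k] by simp
  have hI: "(\<integral>x. h k x \<partial>?M) \<le> I - l * \<delta>" for k
    using sup[OF att(3)[of k]] att(1,2)[of k] by (simp add: h_def algebra_simps)
  have hf: "f x \<le> h k x" for k x using zb(2) by (simp add: h_def)
  (* the excess of phi over f is nonnegative, as staying at x is an option *)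
  define u where "u x = e2ennreal (phi c f l x - ereal (f x))" for x
  define B where "B = I - l * \<delta> - (\<integral>x. f x \<partial>\<mu>)"
  have B0: "0 \<le> B"
    using sup[OF diagonal_attainable] by (simp add: B_def)
  have nn: "(\<integral>\<^sup>+x. ennreal (h k x - f x) \<partial>?M) \<le> ennreal B" for k
  proof -
    have "(\<integral>\<^sup>+x. ennreal (h k x - f x) \<partial>?M) = ennreal (\<integral>x. h k x - f x \<partial>?M)"
      using hi fi hf by (intro nn_integral_eq_integral) auto
    also have "\<dots> \<le> ennreal B"
      using hi[of k] fi hI[of k] fc by (intro ennreal_leI) (simp add: B_def)
    finally show ?thesis .
  qed
  have ulim: "(\<lambda>k. ennreal (h k x - f x)) \<longlonglongrightarrow> u x" for x
  proof -
    have "(\<lambda>k. ereal (h k x)) \<longlonglongrightarrow> phi c f l x"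
      unfolding lim h_def using inc[of x] by (intro LIMSEQ_SUP) (simp add: incseq_def)
    then have "(\<lambda>k. ereal (h k x) - ereal (f x)) \<longlonglongrightarrow> phi c f l x - ereal (f x)"
      unfolding minus_ereal_def by (intro tendsto_add_ereal_general1 tendsto_const) simp_all
    then have "(\<lambda>k. e2ennreal (ereal (h k x) - ereal (f x))) \<longlonglongrightarrow> u x"
      unfolding u_def by (rule tendsto_e2ennrealI)
    then show ?thesis by simp
  qed
  have um: "u \<in> borel_measurable ?M"
    unfolding u_def using measurable_universal_algebra_completion[OF phi_universally_measurable[OF l] \<mu>] fi
    by measurable
  have "(\<lambda>k. \<integral>\<^sup>+x. ennreal (h k x - f x) \<partial>?M) \<longlonglongrightarrow> (\<integral>\<^sup>+x. u x \<partial>?M)"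
  proof (rule nn_integral_LIMSEQ[OF _ _ ulim])
    show "incseq (\<lambda>k x. ennreal (h k x - f x))"
      using inc by (auto simp: incseq_def le_fun_def h_def intro!: ennreal_leI)
    show "(\<lambda>x. ennreal (h k x - f x)) \<in> borel_measurable ?M" for k using hi[of k] fi by simp
  qed
  then have U: "(\<integral>\<^sup>+x. u x \<partial>?M) \<le> ennreal B"
    by (rule LIMSEQ_le_const2) (use nn in blast)
  have phi_eq: "phi c f l x = ereal (f x) + enn2ereal (u x)" for x
    using phi_ge[of x l x] unfolding u_def c_refl
    by (cases "phi c f l x") (auto simp: enn2ereal_e2ennreal)
  have "ext_integral ?M (phi c f l) = ereal (\<integral>x. f x \<partial>?M) + enn2ereal (\<integral>\<^sup>+x. u x \<partial>?M)"
    unfolding phi_eq[abs_def] by (rule ext_integral_add_nonneg[OF fi um])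
  then have "dual_objective \<mu> \<delta> (l, phi c f l) = ereal (l * \<delta>) + (ereal (\<integral>x. f x \<partial>\<mu>) + enn2ereal (\<integral>\<^sup>+x. u x \<partial>?M))"
    by (simp add: dual_objective_def fc)
  also have "\<dots> \<le> ereal I"
    using U B0 by (cases "\<integral>\<^sup>+x. u x \<partial>?M") (auto simp: B_def top_unique)
  finally show ?thesis .
qed

lemma dual_attained:
  assumes \<delta>: "0 < \<delta>" and I: "primal_value c f \<mu> \<delta> = ereal I"
  shows "\<exists>l\<ge>0. dual_objective \<mu> \<delta> (l, phi c f l) \<le> primal_value c f \<mu> \<delta>"
proof -
  have "v \<le> I" if "(k, v) \<in> attainable" "k \<le> \<delta>" for k v
    using attainable_le_primal_value[OF that] by (simp add: I)
  then obtain l where l: "0 \<le> l" "\<forall>(k, v)\<in>attainable. v + l * (\<delta> - k) \<le> I"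
    using supergradient_at_interior_point[OF convex_attainable diagonal_attainable \<delta>, of I] by blast
  then have "dual_objective \<mu> \<delta> (l, phi c f l) \<le> ereal I"
    by (intro dual_objective_phi_le) auto
  with l I show ?thesis by auto
qed

end

section \<open>Strong duality and complementary slackness\<close>

context transport_problem
begin

lemma weak_duality:
  assumes \<pi>: "\<pi> \<in> primal_feasible c \<mu> \<delta>" "neg_part_integrable f \<pi>" and dual: "(l, \<phi>) \<in> dual_feasible c f"
  shows "primal_objective f \<pi> \<le> dual_objective \<mu> \<delta> (l, \<phi>)"
proof -
  have p: "\<pi> \<in> plans" "integrable \<pi> (\<lambda>p. c (fst p) (snd p))" "cost \<pi> \<le> \<delta>"
    using \<pi>(1) by (auto simp: primal_feasible_iff)
  have "0 \<le> l" using dual by (simp add: dual_feasible_def)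
  with p(3) have "0 \<le> enn2ereal (\<integral>\<^sup>+p. slack l \<phi> p \<partial>\<pi>) + ereal (l * (\<delta> - cost \<pi>))"
    by (intro add_nonneg_nonneg) simp_all
  from add_left_mono[OF this, of "primal_objective f \<pi>"] show ?thesis
    unfolding duality_gap(1)[OF p(1,2) \<pi>(2) dual] by simp
qed

lemma primal_le_dual: "primal_value c f \<mu> \<delta> \<le> dual_value c f \<mu> \<delta>"
  unfolding primal_value_def dual_value_def
  by (intro SUP_least INF_greatest) (auto intro: weak_duality)

lemma strong_duality:
  assumes \<delta>: "0 < \<delta>"
  shows "primal_value c f \<mu> \<delta> = dual_value c f \<mu> \<delta>"
    and "\<exists>l\<ge>0. dual_optimizer c f \<mu> \<delta> (l, phi c f l)"
proof -
  have le: "dual_value c f \<mu> \<delta> \<le> dual_objective \<mu> \<delta> (l, phi c f l)" if "0 \<le> l" for l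
    unfolding dual_value_def using that by (intro INF_lower) (simp add: phi_dual_feasible)
  have lower: "ereal (\<integral>x. f x \<partial>\<mu>) \<le> primal_value c f \<mu> \<delta>"
    using attainable_le_primal_value[OF diagonal_attainable] \<delta> by simp
  obtain l where l: "0 \<le> l" "dual_objective \<mu> \<delta> (l, phi c f l) \<le> primal_value c f \<mu> \<delta>"
  proof (cases "primal_value c f \<mu> \<delta>")
    case (real I) with dual_attained[OF \<delta> real] that show ?thesis by blast
  next
    case PInf with that[of 0] show ?thesis by simp
  next
    case MInf with lower show ?thesis by simp
  qed
  show eq: "primal_value c f \<mu> \<delta> = dual_value c f \<mu> \<delta>"
    using le[OF l(1)] l(2) primal_le_dual[of \<delta>] by (intro antisym) auto
  show "\<exists>l\<ge>0. dual_optimizer c f \<mu> \<delta> (l, phi c f l)"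
    using l le[OF l(1)] eq by (intro exI[of _ l]) (simp add: dual_optimizer_def phi_dual_feasible)
qed

lemma slack_phi_eq_0_iff:
  "slack l (phi c f l) p = 0 \<longleftrightarrow> ereal (f (snd p) - l * c (fst p) (snd p)) = phi c f l (fst p)"
proof -
  have "ereal (f (snd p) - l * c (fst p) (snd p)) \<le> phi c f l (fst p)" by (rule phi_ge)
  then show ?thesis unfolding slack_def
    by (cases "phi c f l (fst p)") (auto simp: ennreal_eq_0_iff)
qed

lemma complementary_slackness_iff:
  assumes \<pi>: "\<pi> \<in> primal_feasible c \<mu> \<delta>"
  shows "complementary_slackness c f \<delta> \<pi> l \<longleftrightarrow>
    (AE p in \<pi>. slack l (phi c f l) p = 0) \<and> l * (\<delta> - cost \<pi>) = 0"
proof -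
  have "\<pi> \<in> plans" "integrable \<pi> (\<lambda>p. c (fst p) (snd p))"
    using \<pi> by (auto simp: primal_feasible_iff)
  then show ?thesis
    by (simp add: complementary_slackness_def transport_cost_eq slack_phi_eq_0_iff phi_def case_prod_beta' zero_ereal_def eq_commute[of \<delta>])
qed

text \<open>
  Without slack, \<open>f y = phi c f l x + l * c x y \<ge> f x\<close> almost surely: mass only moves to where \<open>f\<close> is
  at least as large.
\<close>

lemma neg_part_integrable_if_no_slack:
  assumes \<pi>: "\<pi> \<in> plans" and l: "0 \<le> l" and no_slack: "AE p in \<pi>. slack l (phi c f l) p = 0"
  shows "neg_part_integrable f \<pi>"
proof -
  have "(\<integral>\<^sup>+p. ennreal (- f (snd p)) \<partial>\<pi>) \<le> (\<integral>\<^sup>+p. ennreal (- f (fst p)) \<partial>\<pi>)"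
  proof (rule nn_integral_mono_AE)
    show "AE p in \<pi>. ennreal (- f (snd p)) \<le> ennreal (- f (fst p))"
      using no_slack
    proof eventually_elim
      case (elim p)
      then have "ereal (f (fst p)) \<le> ereal (f (snd p) - l * c (fst p) (snd p))"
        using phi_ge[of "fst p" l "fst p"] by (simp add: slack_phi_eq_0_iff c_refl)
      moreover have "0 \<le> l * c (fst p) (snd p)" using l c_nonneg by simp
      ultimately show ?case by (intro ennreal_leI) simp
    qed
  qed
  also have "\<dots> < \<infinity>"
    using plan_integral_fst(1)[OF \<pi>] by (simp add: real_integrable_def less_top)
  finally show ?thesis by (simp add: neg_part_integrable_iff)
qed

lemma slackness_imp_optimal:
  assumes \<pi>: "\<pi> \<in> primal_feasible c \<mu> \<delta>" and l: "0 \<le> l"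
    and cs: "complementary_slackness c f \<delta> \<pi> l"
  shows "primal_optimizer c f \<mu> \<delta> \<pi>" "dual_optimizer c f \<mu> \<delta> (l, phi c f l)"
    "primal_objective f \<pi> = dual_objective \<mu> \<delta> (l, phi c f l)"
proof -
  have p: "\<pi> \<in> plans" "integrable \<pi> (\<lambda>p. c (fst p) (snd p))"
    using \<pi> by (auto simp: primal_feasible_iff)
  have ns: "AE p in \<pi>. slack l (phi c f l) p = 0" and eq: "l * (\<delta> - cost \<pi>) = 0"
    using cs unfolding complementary_slackness_iff[OF \<pi>] by auto
  have neg: "neg_part_integrable f \<pi>" by (rule neg_part_integrable_if_no_slack[OF p(1) l ns])
  have feas: "(l, phi c f l) \<in> dual_feasible c f" using l by (simp add: phi_dual_feasible)
  have "(\<integral>\<^sup>+p. slack l (phi c f l) p \<partial>\<pi>) = 0"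
    using nn_integral_cong_AE[OF ns] by simp
  then show IJ: "primal_objective f \<pi> = dual_objective \<mu> \<delta> (l, phi c f l)"
    using duality_gap(1)[OF p neg feas, of \<delta>] eq by (simp add: zero_ennreal.rep_eq zero_ereal_def[symmetric])
  have "primal_objective f \<pi> \<le> primal_value c f \<mu> \<delta>"
    unfolding primal_value_def using \<pi> neg by (intro SUP_upper) simp
  moreover have "dual_value c f \<mu> \<delta> \<le> dual_objective \<mu> \<delta> (l, phi c f l)"
    unfolding dual_value_def using feas by (rule INF_lower)
  ultimately have "primal_objective f \<pi> = primal_value c f \<mu> \<delta>"
      "dual_objective \<mu> \<delta> (l, phi c f l) = dual_value c f \<mu> \<delta>"
    using primal_le_dual[of \<delta>] IJ by auto
  then show "primal_optimizer c f \<mu> \<delta> \<pi>" "dual_optimizer c f \<mu> \<delta> (l, phi c f l)"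
    using \<pi> neg feas by (simp_all add: primal_optimizer_def dual_optimizer_def)
qed

text \<open>
  A finite common value can be cancelled from the gap identity, so the two nonnegative terms add up
  to \<open>0\<close>.
\<close>

lemma optimal_imp_slackness:
  assumes \<delta>: "0 < \<delta>" and fin: "dual_value c f \<mu> \<delta> < \<infinity>" and l: "0 \<le> l"
    and primal: "primal_optimizer c f \<mu> \<delta> \<pi>"
    and IJ: "primal_objective f \<pi> = dual_objective \<mu> \<delta> (l, phi c f l)"
  shows "complementary_slackness c f \<delta> \<pi> l"
proof -
  have \<pi>: "\<pi> \<in> primal_feasible c \<mu> \<delta>" and neg: "neg_part_integrable f \<pi>"
    and opt: "primal_objective f \<pi> = primal_value c f \<mu> \<delta>"
    using primal by (auto simp: primal_optimizer_def)
  have p: "\<pi> \<in> plans" "integrable \<pi> (\<lambda>p. c (fst p) (snd p))" "cost \<pi> \<le> \<delta>"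
    using \<pi> by (auto simp: primal_feasible_iff)
  have feas: "(l, phi c f l) \<in> dual_feasible c f" using l by (simp add: phi_dual_feasible)
  have "ereal (\<integral>x. f x \<partial>\<mu>) \<le> primal_value c f \<mu> \<delta>"
    using attainable_le_primal_value[OF diagonal_attainable] \<delta> by simp
  then obtain r where r: "primal_objective f \<pi> = ereal r"
    using fin opt strong_duality(1)[OF \<delta>] by (cases "dual_value c f \<mu> \<delta>") auto
  let ?S = "\<integral>\<^sup>+p. slack l (phi c f l) p \<partial>\<pi>"
  have sum: "ereal r = ereal r + (enn2ereal ?S + ereal (l * (\<delta> - cost \<pi>)))"
    using duality_gap(1)[OF p(1,2) neg feas, of \<delta>] IJ r by simp
  have nonneg: "0 \<le> l * (\<delta> - cost \<pi>)" using l p(3) by simp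
  have "?S = 0 \<and> l * (\<delta> - cost \<pi>) = 0"
  proof (cases ?S)
    case (real s)
    then have "s + l * (\<delta> - cost \<pi>) = 0" using sum by simp
    then have "s = 0" "l * (\<delta> - cost \<pi>) = 0" using real(1) nonneg by linarith+
    then show ?thesis using real by simp
  next
    case top then show ?thesis using sum by simp
  qed
  then have S: "?S = 0" and eq: "l * (\<delta> - cost \<pi>) = 0" by blast+
  obtain s where s: "s \<in> borel_measurable \<pi>" "AE p in \<pi>. slack l (phi c f l) p = s p"
    using duality_gap(2)[OF p(1,2) neg feas] by blast
  have "(\<integral>\<^sup>+p. s p \<partial>\<pi>) = 0" using nn_integral_cong_AE[OF s(2)] S by simp
  then have "AE p in \<pi>. s p = 0" using nn_integral_0_iff_AE[OF s(1)] by simp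
  with s(2) have "AE p in \<pi>. slack l (phi c f l) p = 0" by eventually_elim simp
  with eq show ?thesis unfolding complementary_slackness_iff[OF \<pi>] by simp
qed

end

theorem theorem1:
  fixes \<mu> :: "'a::polish_space measure"
    and c :: "'a \<Rightarrow> 'a \<Rightarrow> real" and f :: "'a \<Rightarrow> real" and \<delta> :: real
  assumes "\<mu> \<in> borel_prob_measures"
    and "\<delta> > 0"
    and "\<And>x y. 0 \<le> c x y"
    and "lower_semicontinuous (\<lambda>(x, y). c x y)"
    and "\<And>x y. c x y = 0 \<longleftrightarrow> x = y"
    and "upper_semicontinuous f"
    and "integrable \<mu> f"
  shows "primal_value c f \<mu> \<delta> = dual_value c f \<mu> \<delta>
    \<and> (\<exists>l\<ge>0. dual_optimizer c f \<mu> \<delta> (l, phi c f l))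
    \<and> (\<forall>\<pi>\<in>primal_feasible c \<mu> \<delta>. \<forall>l. (l, phi c f l) \<in> dual_feasible c f \<longrightarrow>
         (dual_value c f \<mu> \<delta> < \<infinity> \<longrightarrow>
           (primal_optimizer c f \<mu> \<delta> \<pi> \<and> dual_optimizer c f \<mu> \<delta> (l, phi c f l) \<and>
            primal_objective f \<pi> = dual_objective \<mu> \<delta> (l, phi c f l)
            \<longleftrightarrow> complementary_slackness c f \<delta> \<pi> l)) \<and>
         (complementary_slackness c f \<delta> \<pi> l \<longrightarrow>
            primal_optimizer c f \<mu> \<delta> \<pi> \<and> dual_optimizer c f \<mu> \<delta> (l, phi c f l) \<and>
            primal_objective f \<pi> = dual_objective \<mu> \<delta> (l, phi c f l)))"
proof -
  interpret transport_problem \<mu> c f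
    using assms by unfold_locales auto
  show ?thesis
  proof (intro conjI ballI allI impI)
    show "primal_value c f \<mu> \<delta> = dual_value c f \<mu> \<delta>"
      and "\<exists>l\<ge>0. dual_optimizer c f \<mu> \<delta> (l, phi c f l)"
      by (fact strong_duality[OF \<open>\<delta> > 0\<close>])+
  next
    fix \<pi> l
    assume \<pi>: "\<pi> \<in> primal_feasible c \<mu> \<delta>" and "(l, phi c f l) \<in> dual_feasible c f"
    then have l: "0 \<le> l" by (simp add: phi_dual_feasible)
    show "complementary_slackness c f \<delta> \<pi> l \<Longrightarrow> primal_optimizer c f \<mu> \<delta> \<pi>"
      and "complementary_slackness c f \<delta> \<pi> l \<Longrightarrow> dual_optimizer c f \<mu> \<delta> (l, phi c f l)"
      and "complementary_slackness c f \<delta> \<pi> l \<Longrightarrow>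
        primal_objective f \<pi> = dual_objective \<mu> \<delta> (l, phi c f l)"
      by (fact slackness_imp_optimal[OF \<pi> l])+
    show "primal_optimizer c f \<mu> \<delta> \<pi> \<and> dual_optimizer c f \<mu> \<delta> (l, phi c f l) \<and>
        primal_objective f \<pi> = dual_objective \<mu> \<delta> (l, phi c f l)
        \<longleftrightarrow> complementary_slackness c f \<delta> \<pi> l"
      if "dual_value c f \<mu> \<delta> < \<infinity>"
      using slackness_imp_optimal[OF \<pi> l] optimal_imp_slackness[OF \<open>\<delta> > 0\<close> that l, of \<pi>] by argo
  qed
qed

end
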